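(* Let $\mathcal{Q}$ be a conjugate-invariant subfield of $\mathbb{C}$ that is not contained in $\mathbb{R}$, and let $(X,L)$, with $X\subset\mathbb{C}^n$, be a real algebraic variety which is defined over $\mathcal{Q}$, which is not already defined over $\mathcal{Q}\cap\mathbb{R}$, and which satisfies $X\cap\overline{X}=\emptyset$. Let $R:X\to\mathbb{C}^{(n^2+3n)/2}$ be the rational map that sends $x=(x_1,\ldots,x_n)\in X$, with $z=(z_1,\ldots,z_n)=J_n(L(x))\in\overline{X}$, to the point whose $(n^2+3n)/2$ coordinates are $$t_{1,j}=x_j+z_j\ (1\le j\le n),\qquad t_{2,j}=x_jz_j\ (1\le j\le n),\qquad t_{i+2,j-i}=x_ix_j+z_iz_j\ (1\le i<j\le n).$$ Then the following hold. (1) $Z=R(X)$ is defined over $\mathcal{Q}\cap\mathbb{R}$. (2) $R:X\to Z$ is a birational isomorphism (biregular if $J_n\circ L$ is a polynomial map), defined over $\mathcal{Q}$. (3) $R\circ L\circ R^{-1}=J_{(n^2+3n)/2}$ (on $Z$).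
   Context: $J_m:\mathbb{C}^m\to\mathbb{C}^m$ denotes the usual conjugation map $J_m(y_1,\ldots,y_m)=(\overline{y_1},\ldots,\overline{y_m})$. Let $X\subset\mathbb{C}^n$ be a complex smooth algebraic variety (the zero set of finitely many polynomials) and set $\overline{X}=J_n(X)$. A symmetry of $X$ is an antiholomorphic automorphism $L:X\to X$ of order two such that $J_n\circ L:X\to\overline{X}$ is a biregular isomorphism. A real algebraic variety is a pair $(X,L)$ where $X$ is a complex smooth algebraic variety and $L$ is a symmetry of $X$. For a subfield $\mathcal{F}$ of $\mathbb{C}$, $(X,L)$ is defined over $\mathcal{F}$ if both $X$ and $J_n\circ L$ are defined over $\mathcal{F}$ (by polynomials, respectively rational functions, with coefficients in $\mathcal{F}$). A subfield $\mathcal{Q}$ of $\mathbb{C}$ is conjugate-invariant if $J_1(\mathcal{Q})=\mathcal{Q}$. *)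

theory Defs
  imports
    "HOL-Algebra.Subrings"
    "HOL-Library.Poly_Mapping"
    "Jordan_Normal_Form.VS_Connect"
begin

text \<open>Points of \<open>\<complex>\<^sup>n\<close> are the elements of \<^term>\<open>carrier_vec n :: complex vec set\<close>, with coordinates
  indexed by \<open>0, \<dots>, n - 1\<close>.\<close>

definition conj_map :: "complex vec \<Rightarrow> complex vec" where
  "conj_map = map_vec cnj"

lemma conj_map_conj_map [simp]: "conj_map (conj_map x) = x"
  by (auto simp: conj_map_def)

text \<open>Subfields of \<open>\<complex>\<close> are those of the library, taken in the ring record of the type
  \<^typ>\<open>complex\<close>.\<close>

abbreviation complex_subfield :: "complex set \<Rightarrow> bool" where
  "complex_subfield F \<equiv> subfield F (class_ring :: complex ring)"

text \<open>A polynomial maps monomials (finitely supported exponent functions) to coefficients.\<close>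

type_synonym cpoly = "(nat \<Rightarrow>\<^sub>0 nat) \<Rightarrow>\<^sub>0 complex"

definition polys_over :: "complex set \<Rightarrow> nat \<Rightarrow> cpoly set" where
  "polys_over F n = {p. (\<forall>m\<in>Poly_Mapping.keys p. Poly_Mapping.keys m \<subseteq> {..<n}) \<and>
     (\<forall>m. Poly_Mapping.lookup p m \<in> F)}"

definition poly_eval :: "cpoly \<Rightarrow> complex vec \<Rightarrow> complex" where
  "poly_eval p x = (\<Sum>m\<in>Poly_Mapping.keys p. Poly_Mapping.lookup p m *
     (\<Prod>i\<in>Poly_Mapping.keys m. (x $ i) ^ Poly_Mapping.lookup m i))"

definition poly_partial :: "nat \<Rightarrow> cpoly \<Rightarrow> cpoly" where
  "poly_partial i p = (\<Sum>m\<in>Poly_Mapping.keys p.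
     Poly_Mapping.single (m - Poly_Mapping.single i 1)
       (of_nat (Poly_Mapping.lookup m i) * Poly_Mapping.lookup p m))"

definition algebraic_set_over :: "complex set \<Rightarrow> nat \<Rightarrow> complex vec set \<Rightarrow> bool" where
  "algebraic_set_over F n X \<longleftrightarrow> (\<exists>S. finite S \<and> S \<subseteq> polys_over F n \<and>
     X = {x \<in> carrier_vec n. \<forall>p\<in>S. poly_eval p x = 0})"

abbreviation algebraic_set :: "nat \<Rightarrow> complex vec set \<Rightarrow> bool" where
  "algebraic_set \<equiv> algebraic_set_over UNIV"

definition irreducible_set :: "nat \<Rightarrow> complex vec set \<Rightarrow> bool" where
  "irreducible_set n Y \<longleftrightarrow> algebraic_set n Y \<and> Y \<noteq> {} \<and>
     (\<forall>A B. algebraic_set n A \<longrightarrow> algebraic_set n B \<longrightarrow> Y = A \<union> B \<longrightarrow> Y = A \<or> Y = B)"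

text \<open>The dimension of \<open>X\<close> at \<open>p\<close>: the supremum of the lengths \<open>k\<close> of chains
  \<open>Z 0 \<subset> \<dots> \<subset> Z k\<close> of irreducible closed subsets of \<open>X\<close> through \<open>p\<close>. The lengths are bounded by
  \<open>n\<close>, so the \<^const>\<open>Sup\<close> over \<^typ>\<open>nat\<close> is a maximum.\<close>

definition local_dim :: "nat \<Rightarrow> complex vec set \<Rightarrow> complex vec \<Rightarrow> nat" where
  "local_dim n X p = Sup {k. \<exists>Z :: nat \<Rightarrow> complex vec set. p \<in> Z 0 \<and>
     (\<forall>i\<le>k. irreducible_set n (Z i) \<and> Z i \<subseteq> X) \<and> (\<forall>i<k. Z i \<subset> Z (Suc i))}"

definition vanishing_ideal :: "nat \<Rightarrow> complex vec set \<Rightarrow> cpoly set" where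
  "vanishing_ideal n X = {f \<in> polys_over UNIV n. \<forall>x\<in>X. poly_eval f x = 0}"

definition tangent_space :: "nat \<Rightarrow> complex vec set \<Rightarrow> complex vec \<Rightarrow> complex vec set" where
  "tangent_space n X p = {v \<in> carrier_vec n. \<forall>f\<in>vanishing_ideal n X.
     (\<Sum>i<n. poly_eval (poly_partial i f) p * v $ i) = 0}"

definition smooth_set :: "nat \<Rightarrow> complex vec set \<Rightarrow> bool" where
  "smooth_set n X \<longleftrightarrow> (\<forall>p\<in>X.
     vectorspace.dim class_ring
       ((module_vec TYPE(complex) n)\<lparr>carrier := tangent_space n X p\<rparr>) = local_dim n X p)"

definition smooth_variety :: "nat \<Rightarrow> complex vec set \<Rightarrow> bool" where
  "smooth_variety n X \<longleftrightarrow> algebraic_set n X \<and> smooth_set n X"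

text \<open>\<open>U\<close> will be a Zariski open subset of an algebraic set. A map is regular over \<open>F\<close> if around
  every point each coordinate is a quotient of polynomials over \<open>F\<close>; since the sets on which a
  polynomial does not vanish form a basis of the Zariski topology, the neighbourhood can be taken to
  be the whole non-vanishing set of the denominator. \<open>F = UNIV\<close> gives the usual regular maps.\<close>

definition regular_map_over ::
  "complex set \<Rightarrow> nat \<Rightarrow> complex vec set \<Rightarrow> nat \<Rightarrow> (complex vec \<Rightarrow> complex vec) \<Rightarrow> bool" where
  "regular_map_over F n U m T \<longleftrightarrow> (\<forall>x\<in>U. T x \<in> carrier_vec m \<and>
     (\<forall>i<m. \<exists>f\<in>polys_over F n. \<exists>g\<in>polys_over F n. poly_eval g x \<noteq> 0 \<and>
        (\<forall>y\<in>U. poly_eval g y \<noteq> 0 \<longrightarrow> T y $ i = poly_eval f y / poly_eval g y)))"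

definition polynomial_map ::
  "nat \<Rightarrow> complex vec set \<Rightarrow> nat \<Rightarrow> (complex vec \<Rightarrow> complex vec) \<Rightarrow> bool" where
  "polynomial_map n X m T \<longleftrightarrow> (\<forall>x\<in>X. T x \<in> carrier_vec m) \<and>
     (\<forall>i<m. \<exists>f\<in>polys_over UNIV n. \<forall>x\<in>X. T x $ i = poly_eval f x)"

definition biregular_over ::
  "complex set \<Rightarrow> nat \<Rightarrow> complex vec set \<Rightarrow> nat \<Rightarrow> complex vec set \<Rightarrow>
   (complex vec \<Rightarrow> complex vec) \<Rightarrow> bool" where
  "biregular_over F n X m Y T \<longleftrightarrow> bij_betw T X Y \<and>
     regular_map_over F n X m T \<and> regular_map_over F m Y n (the_inv_into X T)"

definition open_dense_over ::
  "complex set \<Rightarrow> nat \<Rightarrow> complex vec set \<Rightarrow> complex vec set \<Rightarrow> bool" where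
  "open_dense_over F n X U \<longleftrightarrow> (\<exists>A. algebraic_set_over F n A \<and> U = X - A) \<and>
     (\<forall>A. algebraic_set n A \<longrightarrow> U \<subseteq> A \<longrightarrow> X \<subseteq> A)"

definition birational_over ::
  "complex set \<Rightarrow> nat \<Rightarrow> complex vec set \<Rightarrow> nat \<Rightarrow> complex vec set \<Rightarrow>
   (complex vec \<Rightarrow> complex vec) \<Rightarrow> bool" where
  "birational_over F n X m Y T \<longleftrightarrow> (\<exists>U V. open_dense_over F n X U \<and> open_dense_over F m Y V \<and>
     biregular_over F n U m V T)"

definition complex_differentiable_at ::
  "nat \<Rightarrow> (complex vec \<Rightarrow> complex) \<Rightarrow> complex vec \<Rightarrow> bool" where
  "complex_differentiable_at n f x \<longleftrightarrow> (\<exists>a :: nat \<Rightarrow> complex. \<forall>\<epsilon>>0. \<exists>\<delta>>0. \<forall>y\<in>carrier_vec n.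
     (\<forall>i<n. cmod (y $ i - x $ i) < \<delta>) \<longrightarrow>
     cmod (f y - f x - (\<Sum>i<n. a i * (y $ i - x $ i))) \<le> \<epsilon> * (\<Sum>i<n. cmod (y $ i - x $ i)))"

text \<open>A map on a (sub)manifold of \<open>\<complex>\<^sup>n\<close> is holomorphic if it extends, locally at each point, to a
  holomorphic map on a neighbourhood in \<open>\<complex>\<^sup>n\<close>.\<close>

definition holomorphic_map ::
  "nat \<Rightarrow> complex vec set \<Rightarrow> nat \<Rightarrow> (complex vec \<Rightarrow> complex vec) \<Rightarrow> bool" where
  "holomorphic_map n X m T \<longleftrightarrow> (\<forall>x\<in>X. T x \<in> carrier_vec m \<and>
     (\<forall>i<m. \<exists>r>0. \<exists>f. \<forall>y\<in>carrier_vec n. (\<forall>j<n. cmod (y $ j - x $ j) < r) \<longrightarrow>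
        complex_differentiable_at n f y \<and> (y \<in> X \<longrightarrow> T y $ i = f y)))"

definition antiholomorphic_map ::
  "nat \<Rightarrow> complex vec set \<Rightarrow> nat \<Rightarrow> (complex vec \<Rightarrow> complex vec) \<Rightarrow> bool" where
  "antiholomorphic_map n X m T \<longleftrightarrow> holomorphic_map n X m (conj_map \<circ> T)"

text \<open>Only the values of \<open>L\<close> on \<open>X\<close> matter; the inverse of \<open>L\<close> is \<open>L\<close> itself.\<close>

definition symmetry :: "nat \<Rightarrow> complex vec set \<Rightarrow> (complex vec \<Rightarrow> complex vec) \<Rightarrow> bool" where
  "symmetry n X L \<longleftrightarrow> bij_betw L X X \<and> antiholomorphic_map n X n L \<and>
     (\<forall>x\<in>X. L (L x) = x) \<and> (\<exists>x\<in>X. L x \<noteq> x) \<and>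
     biregular_over UNIV n X n (conj_map ` X) (conj_map \<circ> L)"

definition real_algebraic_variety ::
  "nat \<Rightarrow> complex vec set \<Rightarrow> (complex vec \<Rightarrow> complex vec) \<Rightarrow> bool" where
  "real_algebraic_variety n X L \<longleftrightarrow> smooth_variety n X \<and> symmetry n X L"

definition real_variety_defined_over ::
  "complex set \<Rightarrow> nat \<Rightarrow> complex vec set \<Rightarrow> (complex vec \<Rightarrow> complex vec) \<Rightarrow> bool" where
  "real_variety_defined_over F n X L \<longleftrightarrow>
     algebraic_set_over F n X \<and> regular_map_over F n X n (conj_map \<circ> L)"

text \<open>The coordinates are listed in the order \<open>t\<^sub>1\<^sub>,\<^sub>j\<close>, \<open>t\<^sub>2\<^sub>,\<^sub>j\<close>, and then
  \<open>t\<^sub>i\<^sub>+\<^sub>2\<^sub>,\<^sub>j\<^sub>-\<^sub>i\<close> for \<open>i < j\<close> in lexicographic order.\<close>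

definition R_map :: "nat \<Rightarrow> (complex vec \<Rightarrow> complex vec) \<Rightarrow> complex vec \<Rightarrow> complex vec" where
  "R_map n L x = (let z = conj_map (L x) in vec_of_list (
     [x $ j + z $ j. j \<leftarrow> [0..<n]] @
     [x $ j * z $ j. j \<leftarrow> [0..<n]] @
     [x $ i * x $ j + z $ i * z $ j. i \<leftarrow> [0..<n], j \<leftarrow> [Suc i..<n]]))"

lemma R_map_carrier: "R_map n L x \<in> carrier_vec ((n^2 + 3 * n) div 2)"
proof -
  have *: "2 * sum_list (map (\<lambda>i. n - Suc i) [0..<n]) + n = n * n"
  proof (induction n)
    case (Suc n)
    have "map (\<lambda>i. Suc n - Suc i) [0..<Suc n] = n # map (\<lambda>i. n - Suc i) [0..<n]"
      unfolding map_upt_Suc by simp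
    then have "sum_list (map (\<lambda>i. Suc n - Suc i) [0..<Suc n]) =
        n + sum_list (map (\<lambda>i. n - Suc i) [0..<n])"
      by (simp only: sum_list.Cons)
    with Suc.IH show ?case by (simp only: mult_Suc mult_Suc_right add_mult_distrib2)
  qed simp
  have "n^2 + 3 * n = 2 * (n + (n + sum_list (map (\<lambda>i. n - Suc i) [0..<n])))"
    unfolding power2_eq_square *[symmetric] by simp
  then have "n + (n + sum_list (map (\<lambda>i. n - Suc i) [0..<n])) = (n^2 + 3 * n) div 2"
    by (simp only: nonzero_mult_div_cancel_left)
  then have "dim_vec (R_map n L x) = (n^2 + 3 * n) div 2"
    unfolding R_map_def Let_def dim_vec_of_list length_append length_map length_upt length_concat
      map_map comp_def by simp
  then show ?thesis by (rule carrier_vecI)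
qed

end

theory Submission
  imports Defs "HOL-Library.Function_Algebras"
begin

text \<open>Write \<open>T x = conj_map (L x)\<close>, a regular map from \<open>X\<close> onto the conjugate variety, and let
  \<open>\<Phi>(x, z)\<close> be the vector of the symmetric functions \<open>x\<^sub>j + z\<^sub>j\<close>, \<open>x\<^sub>j z\<^sub>j\<close>,
  \<open>x\<^sub>i x\<^sub>j + z\<^sub>i z\<^sub>j\<close> of two points, so that \<open>R x = \<Phi>(x, T x)\<close>. The coordinates of \<open>\<Phi>\<close> generate
  the polynomials in \<open>(x, z)\<close> that are invariant under swapping \<open>x\<close> and \<open>z\<close>: up to factors \<open>2\<close> they
  amount to the sums \<open>x\<^sub>j + z\<^sub>j\<close> and the products \<open>d\<^sub>i d\<^sub>j\<close> of the differences
  \<open>d\<^sub>i = x\<^sub>i - z\<^sub>i\<close>. Hence every polynomial \<open>h(x, z)\<close> over \<open>Q\<close> has the form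
  \<open>A(\<Phi>) + \<Sum>\<^sub>i B\<^sub>i(\<Phi>) d\<^sub>i\<close> with polynomials \<open>A\<close>, \<open>B\<^sub>i\<close> over \<open>Q\<close>
  (\<open>pair_polyfun_decomposition\<close>), and \<open>\<Phi>(x, z)\<close> determines the pair up to order
  (\<open>symmetric_coords_eqD\<close>).

  Injectivity of \<open>R\<close> follows: the order of the pair \<open>(x, T x)\<close> is known because \<open>x\<close> lies in \<open>X\<close>, \<open>T x\<close>
  in the conjugate of \<open>X\<close>, and these are disjoint. The same observation inverts \<open>R\<close> by regular
  functions: if a polynomial \<open>p\<close> vanishes on the conjugate of \<open>X\<close> but not at a given point of \<open>X\<close>, then
  near that point \<open>x\<^sub>i = (x\<^sub>i p(x) + z\<^sub>i p(z)) / (p(x) + p(z))\<close> for \<open>z = T x\<close>, a quotient of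
  symmetric polynomials (\<open>biregular_R_map\<close>). So \<open>R\<close> is biregular on all of \<open>X\<close>, and the birational
  statement holds with \<open>X\<close> and \<open>R(X)\<close> as the open sets.

  The image \<open>R(X)\<close> is the image under \<open>\<Phi>\<close> of the graph of \<open>T\<close>. The graph is algebraic over \<open>Q\<close>; that
  finitely many of the local quotients representing \<open>T\<close> suffice to describe it is where Hilbert's
  basis theorem enters (\<open>finitely_many_equations\<close>, \<open>algebraic_graph\<close>). The image of \<open>\<Phi>\<close> itself is cut
  out by the condition that the symmetric matrix \<open>(d\<^sub>i d\<^sub>j)\<close> has rank at most one, and the equations of
  the graph together with its swapped copy can be written in terms of \<open>\<Phi>\<close> by the decomposition above
  (\<open>algebraic_image_symmetric_coords\<close>). Thus \<open>R(X)\<close> is algebraic over \<open>Q\<close>.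

  Since \<open>L\<close> is an involution, \<open>L x\<close> and its partner \<open>T (L x)\<close> are the conjugates of \<open>T x\<close> and \<open>x\<close>, and
  the symmetry of \<open>\<Phi>\<close> gives \<open>R (L x) = conj_map (R x)\<close>. In particular \<open>R(X)\<close> is invariant under
  conjugation, so its equations descend from \<open>Q\<close> to \<open>Q \<inter> \<real>\<close> by taking real and imaginary parts
  (\<open>descent_to_real_subfield\<close>).\<close>

section \<open>Subfields of the complex numbers\<close>

lemma complex_subfield_closed:
  assumes "complex_subfield F"
  shows "0 \<in> F" "1 \<in> F"
    and "\<And>a b. a \<in> F \<Longrightarrow> b \<in> F \<Longrightarrow> a + b \<in> F"
    and "\<And>a b. a \<in> F \<Longrightarrow> b \<in> F \<Longrightarrow> a * b \<in> F"
    and "\<And>a. a \<in> F \<Longrightarrow> - a \<in> F"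
    and "\<And>a b. a \<in> F \<Longrightarrow> b \<in> F \<Longrightarrow> a - b \<in> F"
    and "\<And>a. a \<in> F \<Longrightarrow> inverse a \<in> F"
    and "\<And>a b. a \<in> F \<Longrightarrow> b \<in> F \<Longrightarrow> a / b \<in> F"
    and "\<And>k. numeral k \<in> F"
proof -
  have sr: "subring F (class_ring :: complex ring)"
    by (rule subfieldE(1)[OF assms])
  show z: "0 \<in> F" using subringE(2)[OF sr] by simp
  show o: "1 \<in> F" using subringE(3)[OF sr] by simp
  show p: "a + b \<in> F" if "a \<in> F" "b \<in> F" for a b using subringE(7)[OF sr that] by simp
  show t: "a * b \<in> F" if "a \<in> F" "b \<in> F" for a b using subringE(6)[OF sr that] by simp
  show m: "- a \<in> F" if "a \<in> F" for a using subringE(5)[OF sr that] by (simp add: class_ring_simps)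
  show "a - b \<in> F" if "a \<in> F" "b \<in> F" for a b using p[OF that(1) m[OF that(2)]] by simp
  show i: "inverse a \<in> F" if "a \<in> F" for a
  proof (cases "a = 0")
    case False
    then have "a \<in> Units (class_ring \<lparr>carrier := F\<rparr>)"
      using subfield.subfield_Units[OF assms] that by simp
    then obtain b where "b \<in> F" "b * a = 1" unfolding Units_def by auto
    then show ?thesis using inverse_unique[of a b] by (simp add: mult.commute)
  qed (simp add: z)
  show "a / b \<in> F" if "a \<in> F" "b \<in> F" for a b
    using t[OF that(1) i[OF that(2)]] by (simp add: field_simps)
  show "numeral k \<in> F" for k
  proof (induction k)
    case (Bit0 k) then show ?case using p[OF Bit0 Bit0] by (simp add: numeral_Bit0)
  next
    case (Bit1 k) then show ?case using p[OF p[OF Bit1 Bit1] o] by (simp add: numeral_Bit1)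
  qed (simp add: o)
qed

lemma complex_subfieldI:
  assumes "0 \<in> F" "1 \<in> F"
    and "\<And>a b. a \<in> F \<Longrightarrow> b \<in> F \<Longrightarrow> a + b \<in> F"
    and "\<And>a b. a \<in> F \<Longrightarrow> b \<in> F \<Longrightarrow> a * b \<in> F"
    and "\<And>a. a \<in> F \<Longrightarrow> - a \<in> F"
    and "\<And>a. a \<in> F \<Longrightarrow> inverse a \<in> F"
  shows "complex_subfield F"
proof (rule ring.subfieldI[OF class_ring.ring_axioms])
  have "subring F (class_ring :: complex ring)"
    by (rule ring.subringI[OF class_ring.ring_axioms]) (use assms in \<open>auto simp: class_ring_simps\<close>)
  then show "subcring F (class_ring :: complex ring)"
    by (rule ring.subcringI[OF class_ring.ring_axioms]) (simp add: mult.commute)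
  have "b \<in> Units (class_ring\<lparr>carrier := F\<rparr>)" if "b \<in> F" "b \<noteq> 0" for b
    unfolding Units_def using that assms(6)[OF that(1)] by (auto intro!: bexI[of _ "inverse b"])
  then show "Units (class_ring\<lparr>carrier := F\<rparr>) = F - {\<zero>\<^bsub>class_ring\<^esub>}"
    by (auto simp: Units_def)
qed

lemma complex_subfield_Int_Reals:
  assumes "complex_subfield F"
  shows "complex_subfield (F \<inter> \<real>)"
  by (rule complex_subfieldI) (use complex_subfield_closed[OF assms] in auto)

section \<open>Algebras of functions\<close>

text \<open>Polynomials are handled as the functions that they induce. This hides the representation by
  monomials, gives proofs by induction over the way a polynomial is built, and makes substitution
  an instance of closure under composition. The domain is left open because polynomial functions of
  a point and of a pair of points both occur.\<close>

inductive_set function_algebra :: "complex set \<Rightarrow> ('a \<Rightarrow> complex) set \<Rightarrow> ('a \<Rightarrow> complex) set"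
  for F :: "complex set" and G :: "('a \<Rightarrow> complex) set" where
  const: "c \<in> F \<Longrightarrow> (\<lambda>_. c) \<in> function_algebra F G"
| gen: "g \<in> G \<Longrightarrow> g \<in> function_algebra F G"
| add: "f \<in> function_algebra F G \<Longrightarrow> g \<in> function_algebra F G \<Longrightarrow>
    (\<lambda>x. f x + g x) \<in> function_algebra F G"
| mult: "f \<in> function_algebra F G \<Longrightarrow> g \<in> function_algebra F G \<Longrightarrow>
    (\<lambda>x. f x * g x) \<in> function_algebra F G"

abbreviation polyfun :: "complex set \<Rightarrow> nat \<Rightarrow> (complex vec \<Rightarrow> complex) set" where
  "polyfun F n \<equiv> function_algebra F ((\<lambda>i x. x $ i) ` {..<n})"

lemma function_algebra_uminus:
  assumes "complex_subfield F" "f \<in> function_algebra F G"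
  shows "(\<lambda>x. - f x) \<in> function_algebra F G"
  using function_algebra.mult[OF function_algebra.const assms(2), of "-1"]
  by (simp add: complex_subfield_closed[OF assms(1)])

lemma function_algebra_diff:
  assumes "complex_subfield F" "f \<in> function_algebra F G" "g \<in> function_algebra F G"
  shows "(\<lambda>x. f x - g x) \<in> function_algebra F G"
  using function_algebra.add[OF assms(2) function_algebra_uminus[OF assms(1,3)]] by simp

lemma function_algebra_sum:
  assumes "0 \<in> F" "\<And>i. i \<in> I \<Longrightarrow> f i \<in> function_algebra F G"
  shows "(\<lambda>x. \<Sum>i\<in>I. f i x) \<in> function_algebra F G"
  using assms(2)
proof (induction I rule: infinite_finite_induct)
  case (insert i I)
  then show ?case using function_algebra.add[of "f i" F G "\<lambda>x. \<Sum>i\<in>I. f i x"] by simp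
qed (auto intro: function_algebra.const assms(1))

lemma function_algebra_power:
  assumes "1 \<in> F" "f \<in> function_algebra F G"
  shows "(\<lambda>x. f x ^ k) \<in> function_algebra F G"
  by (induction k) (auto intro: function_algebra.intros assms)

lemma function_algebra_prod:
  assumes "1 \<in> F" "\<And>i. i \<in> I \<Longrightarrow> f i \<in> function_algebra F G"
  shows "(\<lambda>x. \<Prod>i\<in>I. f i x) \<in> function_algebra F G"
  using assms(2)
proof (induction I rule: infinite_finite_induct)
  case (insert i I)
  then show ?case using function_algebra.mult[of "f i" F G "\<lambda>x. \<Prod>i\<in>I. f i x"] by simp
qed (auto intro: function_algebra.const assms(1))

lemma function_algebra_compose:
  assumes "f \<in> function_algebra F G" "\<And>g. g \<in> G \<Longrightarrow> (\<lambda>y. g (\<phi> y)) \<in> function_algebra F H"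
  shows "(\<lambda>y. f (\<phi> y)) \<in> function_algebra F H"
  using assms(1) by induction (auto intro: function_algebra.intros assms(2))

section \<open>Polynomials as functions\<close>

lemma poly_eval_superset:
  assumes "finite S" "Poly_Mapping.keys p \<subseteq> S"
  shows "poly_eval p x = (\<Sum>m\<in>S. Poly_Mapping.lookup p m *
     (\<Prod>i\<in>Poly_Mapping.keys m. (x $ i) ^ Poly_Mapping.lookup m i))"
  unfolding poly_eval_def
  by (rule sum.mono_neutral_left) (use assms in \<open>auto simp: in_keys_iff\<close>)

lemma poly_eval_add: "poly_eval (p + q) x = poly_eval p x + poly_eval q x"
proof -
  let ?S = "Poly_Mapping.keys p \<union> Poly_Mapping.keys q"
  have "finite ?S" by simp
  then show ?thesis
    by (subst (1 2 3) poly_eval_superset[of ?S])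
      (auto simp: lookup_add sum.distrib algebra_simps dest: set_mp[OF keys_add])
qed

lemma poly_eval_0 [simp]: "poly_eval 0 x = 0"
  by (simp add: poly_eval_def)

lemma poly_eval_sum: "poly_eval (\<Sum>i\<in>I. p i) x = (\<Sum>i\<in>I. poly_eval (p i) x)"
  by (induction I rule: infinite_finite_induct) (auto simp: poly_eval_add)

lemma poly_eval_single:
  "poly_eval (Poly_Mapping.single m c) x =
     c * (\<Prod>i\<in>Poly_Mapping.keys m. (x $ i) ^ Poly_Mapping.lookup m i)"
  by (cases "c = 0") (simp_all add: poly_eval_def)

lemma sum_single_lookup:
  "(\<Sum>m\<in>Poly_Mapping.keys p. Poly_Mapping.single m (Poly_Mapping.lookup p m)) = p"
  by (rule poly_mapping_eqI)
    (simp add: lookup_sum lookup_single when_def sum.delta in_keys_iff)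

lemma monomial_eval_add:
  fixes a b :: "nat \<Rightarrow>\<^sub>0 nat" and x :: "complex vec"
  shows "(\<Prod>i\<in>Poly_Mapping.keys (a + b). (x $ i) ^ Poly_Mapping.lookup (a + b) i) =
    (\<Prod>i\<in>Poly_Mapping.keys a. (x $ i) ^ Poly_Mapping.lookup a i) *
    (\<Prod>i\<in>Poly_Mapping.keys b. (x $ i) ^ Poly_Mapping.lookup b i)"
proof -
  let ?S = "Poly_Mapping.keys a \<union> Poly_Mapping.keys b"
  \<comment> \<open>Factors with exponent zero are one, so all three products may range over the same set.\<close>
  have sup: "(\<Prod>i\<in>Poly_Mapping.keys m. (x $ i) ^ Poly_Mapping.lookup m i) =
      (\<Prod>i\<in>?S. (x $ i) ^ Poly_Mapping.lookup m i)" if "Poly_Mapping.keys m \<subseteq> ?S" for m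
    by (rule prod.mono_neutral_left) (use that in \<open>auto simp: in_keys_iff\<close>)
  show ?thesis
    using sup[of a] sup[of b] sup[OF keys_add]
    by (simp add: lookup_add power_add prod.distrib)
qed

lemma mult_eq_sum_single:
  "p * q = (\<Sum>a\<in>Poly_Mapping.keys p. \<Sum>b\<in>Poly_Mapping.keys q.
     Poly_Mapping.single (a + b) (Poly_Mapping.lookup p a * Poly_Mapping.lookup q b))"
    for p q :: cpoly
proof -
  have "p * q = (\<Sum>a\<in>Poly_Mapping.keys p. Poly_Mapping.single a (Poly_Mapping.lookup p a)) *
     (\<Sum>b\<in>Poly_Mapping.keys q. Poly_Mapping.single b (Poly_Mapping.lookup q b))"
    by (simp only: sum_single_lookup)
  then show ?thesis by (simp only: sum_product mult_single)
qed

lemma poly_eval_mult: "poly_eval (p * q) x = poly_eval p x * poly_eval q x"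
  unfolding mult_eq_sum_single[of p q] poly_eval_sum poly_eval_single monomial_eval_add
    poly_eval_def[of p] poly_eval_def[of q] sum_product
  by (simp add: algebra_simps)

lemma polys_over_add:
  assumes "complex_subfield F" "p \<in> polys_over F n" "q \<in> polys_over F n"
  shows "p + q \<in> polys_over F n"
  using assms(2,3) set_mp[OF keys_add, of _ p q] complex_subfield_closed(3)[OF assms(1)]
  unfolding polys_over_def by (auto simp: lookup_add; blast)

lemma polys_over_sum:
  assumes F: "complex_subfield F" and p: "\<And>i. i \<in> I \<Longrightarrow> p i \<in> polys_over F n"
  shows "(\<Sum>i\<in>I. p i) \<in> polys_over F n"
proof -
  have "0 \<in> polys_over F n"
    using complex_subfield_closed(1)[OF F] unfolding polys_over_def by auto
  then show ?thesis
    using p by (induction I rule: infinite_finite_induct) (auto intro: polys_over_add[OF F])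
qed

lemma polys_over_single:
  assumes "complex_subfield F" "c \<in> F" "Poly_Mapping.keys m \<subseteq> {..<n}"
  shows "Poly_Mapping.single m c \<in> polys_over F n"
  using assms complex_subfield_closed(1)[OF assms(1)]
  unfolding polys_over_def by (auto simp: lookup_single when_def)

lemma polys_over_mult:
  assumes F: "complex_subfield F" and p: "p \<in> polys_over F n" and q: "q \<in> polys_over F n"
  shows "p * q \<in> polys_over F n"
  unfolding mult_eq_sum_single[of p q]
proof (intro polys_over_sum[OF F] polys_over_single[OF F])
  fix a b assume "a \<in> Poly_Mapping.keys p" "b \<in> Poly_Mapping.keys q"
  then have "Poly_Mapping.keys a \<subseteq> {..<n}" "Poly_Mapping.keys b \<subseteq> {..<n}"
    using p q unfolding polys_over_def by auto
  then show "Poly_Mapping.keys (a + b) \<subseteq> {..<n}"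
    using keys_add[of a b] by blast
  show "Poly_Mapping.lookup p a * Poly_Mapping.lookup q b \<in> F"
    using p q complex_subfield_closed(4)[OF F] unfolding polys_over_def by auto
qed

text \<open>Evaluation is a ring homomorphism, which gives one inclusion; expanding a polynomial into its
  monomials gives the other.\<close>

lemma polyfun_eq_poly_eval:
  assumes F: "complex_subfield F"
  shows "polyfun F n = poly_eval ` polys_over F n"
proof
  show "polyfun F n \<subseteq> poly_eval ` polys_over F n"
  proof
    fix f :: "complex vec \<Rightarrow> complex" assume "f \<in> polyfun F n"
    then show "f \<in> poly_eval ` polys_over F n"
    proof induction
      case (const c)
      have "(\<lambda>_. c) = poly_eval (Poly_Mapping.single 0 c)"
        by (simp add: fun_eq_iff poly_eval_single)
      then show ?case using polys_over_single[OF F const, of 0] by auto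
    next
      case (gen g)
      then obtain i where i: "i < n" "g = (\<lambda>x. x $ i)" by auto
      have "g = poly_eval (Poly_Mapping.single (Poly_Mapping.single i 1) 1)"
        by (simp add: fun_eq_iff poly_eval_single i)
      then show ?case
        using polys_over_single[OF F complex_subfield_closed(2)[OF F], of "Poly_Mapping.single i 1"] i
        by auto
    next
      case (add f g)
      then obtain p q where "p \<in> polys_over F n" "q \<in> polys_over F n"
        "f = poly_eval p" "g = poly_eval q" by auto
      then show ?case
        using polys_over_add[OF F, of p n q]
        by (auto simp: poly_eval_add fun_eq_iff image_iff intro!: bexI[of _ "p + q"])
    next
      case (mult f g)
      then obtain p q where "p \<in> polys_over F n" "q \<in> polys_over F n"
        "f = poly_eval p" "g = poly_eval q" by auto
      then show ?case
        using polys_over_mult[OF F, of p n q]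
        by (auto simp: poly_eval_mult fun_eq_iff image_iff intro!: bexI[of _ "p * q"])
    qed
  qed
  show "poly_eval ` polys_over F n \<subseteq> polyfun F n"
  proof safe
    fix p assume p: "p \<in> polys_over F n"
    have "(\<lambda>x. poly_eval p x) \<in> polyfun F n"
      unfolding poly_eval_def
      by (intro function_algebra_sum function_algebra.mult function_algebra.const
          function_algebra_prod function_algebra_power function_algebra.gen
          complex_subfield_closed[OF F])
        (use p in \<open>auto simp: polys_over_def\<close>)
    then show "poly_eval p \<in> polyfun F n" by (simp add: eta_contract_eq)
  qed
qed

lemma algebraic_set_over_iff_polyfun:
  assumes F: "complex_subfield F"
  shows "algebraic_set_over F n X \<longleftrightarrow>
    (\<exists>H. finite H \<and> H \<subseteq> polyfun F n \<and> X = {x \<in> carrier_vec n. \<forall>h\<in>H. h x = 0})"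
    (is "_ \<longleftrightarrow> (\<exists>H. ?P H)")
proof
  assume "algebraic_set_over F n X"
  then obtain S where "finite S" "S \<subseteq> polys_over F n"
    "X = {x \<in> carrier_vec n. \<forall>p\<in>S. poly_eval p x = 0}"
    unfolding algebraic_set_over_def by auto
  then have "?P (poly_eval ` S)" by (auto simp: polyfun_eq_poly_eval[OF F])
  then show "\<exists>H. ?P H" by (rule exI)
next
  assume "\<exists>H. ?P H"
  then obtain H where H: "finite H" "H \<subseteq> poly_eval ` polys_over F n"
    "X = {x \<in> carrier_vec n. \<forall>h\<in>H. h x = 0}"
    unfolding polyfun_eq_poly_eval[OF F] by auto
  obtain S where "finite S" "S \<subseteq> polys_over F n" "H = poly_eval ` S"
    using finite_subset_image[OF H(1,2)] by auto
  with H(3) show "algebraic_set_over F n X"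
    unfolding algebraic_set_over_def by (intro exI[of _ S]) auto
qed

lemma regular_map_over_iff_polyfun:
  assumes F: "complex_subfield F"
  shows "regular_map_over F n U m T \<longleftrightarrow> (\<forall>x\<in>U. T x \<in> carrier_vec m \<and>
     (\<forall>i<m. \<exists>f\<in>polyfun F n. \<exists>g\<in>polyfun F n. g x \<noteq> 0 \<and>
        (\<forall>y\<in>U. g y \<noteq> 0 \<longrightarrow> T y $ i = f y / g y)))"
  unfolding regular_map_over_def polyfun_eq_poly_eval[OF F] by simp


section \<open>Hilbert's basis theorem\<close>

definition closed_subring :: "'a::comm_ring_1 set \<Rightarrow> bool" where
  "closed_subring A \<longleftrightarrow> 1 \<in> A \<and> (\<forall>a\<in>A. \<forall>b\<in>A. a - b \<in> A \<and> a * b \<in> A)"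

definition ideal_of :: "'a::comm_ring_1 set \<Rightarrow> 'a set \<Rightarrow> bool" where
  "ideal_of A I \<longleftrightarrow> I \<subseteq> A \<and> 0 \<in> I \<and> (\<forall>f\<in>I. \<forall>g\<in>I. f + g \<in> I) \<and> (\<forall>a\<in>A. \<forall>f\<in>I. a * f \<in> I)"

text \<open>The ascending chain condition is used instead of finite generation: it passes to \<open>A[t]\<close> by
  comparing leading coefficients, without choosing generators.\<close>

definition noetherian :: "'a::comm_ring_1 set \<Rightarrow> bool" where
  "noetherian A \<longleftrightarrow> (\<forall>I. (\<forall>j. ideal_of A (I j)) \<longrightarrow> incseq I \<longrightarrow> (\<exists>m. \<forall>j\<ge>m. I j = I m))"

text \<open>This is \<open>A[t]\<close> inside the ambient ring. As \<open>t\<close> may satisfy relations over \<open>A\<close>,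
  an element may be the value of several polynomials; degrees and leading coefficients are those of
  a chosen polynomial, not of its value.\<close>

definition adjoin :: "'a::comm_ring_1 set \<Rightarrow> 'a \<Rightarrow> 'a set" where
  "adjoin A t = {poly p t |p. \<forall>i. coeff p i \<in> A}"

lemma closed_subringD:
  assumes "closed_subring A"
  shows "0 \<in> A" "1 \<in> A"
    and "\<And>a b. a \<in> A \<Longrightarrow> b \<in> A \<Longrightarrow> a + b \<in> A"
    and "\<And>a b. a \<in> A \<Longrightarrow> b \<in> A \<Longrightarrow> a * b \<in> A"
    and "\<And>a. a \<in> A \<Longrightarrow> - a \<in> A"
    and "\<And>a b. a \<in> A \<Longrightarrow> b \<in> A \<Longrightarrow> a - b \<in> A"
proof -
  show m: "a - b \<in> A" and "a * b \<in> A" if "a \<in> A" "b \<in> A" for a b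
    using assms that unfolding closed_subring_def by auto
  show o: "1 \<in> A" using assms unfolding closed_subring_def by auto
  show z: "0 \<in> A" using m[OF o o] by simp
  show u: "- a \<in> A" if "a \<in> A" for a using m[OF z that] by simp
  show "a + b \<in> A" if "a \<in> A" "b \<in> A" for a b using m[OF that(1) u[OF that(2)]] by simp
qed

lemma closed_subring_sum:
  assumes "closed_subring A" "\<And>i. i \<in> I \<Longrightarrow> f i \<in> A"
  shows "sum f I \<in> A"
  using assms(2)
  by (induction I rule: infinite_finite_induct) (auto intro: closed_subringD[OF assms(1)])

lemma coeff_mult_in_subring:
  assumes "closed_subring A" "\<forall>i. coeff p i \<in> A" "\<forall>i. coeff q i \<in> A"
  shows "coeff (p * q) i \<in> A"
  unfolding coeff_mult using assms
  by (auto intro!: closed_subring_sum closed_subringD)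

lemma closed_subring_adjoin:
  assumes "closed_subring A"
  shows "closed_subring (adjoin A t)"
  unfolding closed_subring_def
proof (intro conjI ballI)
  show "1 \<in> adjoin A t"
    unfolding adjoin_def using closed_subringD[OF assms]
    by (intro CollectI exI[of _ 1]) (auto simp: coeff_1)
  fix a b assume "a \<in> adjoin A t" "b \<in> adjoin A t"
  then obtain p q where "a = poly p t" "b = poly q t" "\<forall>i. coeff p i \<in> A" "\<forall>i. coeff q i \<in> A"
    unfolding adjoin_def by auto
  then have "a - b = poly (p - q) t" "\<forall>i. coeff (p - q) i \<in> A"
    and "a * b = poly (p * q) t" "\<forall>i. coeff (p * q) i \<in> A"
    using closed_subringD(6)[OF assms] coeff_mult_in_subring[OF assms, of p q] by auto
  then show "a - b \<in> adjoin A t" "a * b \<in> adjoin A t"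
    unfolding adjoin_def by blast+
qed

lemma subset_adjoin:
  assumes "closed_subring A"
  shows "A \<subseteq> adjoin A t" "t \<in> adjoin A t"
proof -
  show "A \<subseteq> adjoin A t"
  proof
    fix a assume "a \<in> A"
    then show "a \<in> adjoin A t"
      unfolding adjoin_def using closed_subringD(1)[OF assms]
      by (intro CollectI exI[of _ "[:a:]"]) (auto simp: coeff_pCons split: nat.splits)
  qed
  show "t \<in> adjoin A t"
    unfolding adjoin_def using closed_subringD(1,2)[OF assms]
    by (intro CollectI exI[of _ "[:0, 1:]"]) (auto simp: coeff_pCons split: nat.splits)
qed

text \<open>Polynomials of degree less than \<open>k\<close> are admitted and contribute the coefficient \<open>0\<close>, which makes
  this set an ideal of \<open>A\<close>.\<close>

definition leading_coeffs :: "'a::comm_ring_1 set \<Rightarrow> 'a \<Rightarrow> 'a set \<Rightarrow> nat \<Rightarrow> 'a set" where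
  "leading_coeffs A t I k =
     {coeff p k |p. (\<forall>i. coeff p i \<in> A) \<and> (\<forall>i>k. coeff p i = 0) \<and> poly p t \<in> I}"

lemma ideal_of_leading_coeffs:
  assumes A: "closed_subring A" and I: "ideal_of (adjoin A t) I"
  shows "ideal_of A (leading_coeffs A t I k)"
  unfolding ideal_of_def
proof (intro conjI ballI subsetI)
  show "0 \<in> leading_coeffs A t I k"
    unfolding leading_coeffs_def using I closed_subringD(1)[OF A]
    by (intro CollectI exI[of _ 0]) (auto simp: ideal_of_def)
  fix c assume "c \<in> leading_coeffs A t I k"
  then obtain p where p: "c = coeff p k" "\<forall>i. coeff p i \<in> A" "\<forall>i>k. coeff p i = 0" "poly p t \<in> I"
    unfolding leading_coeffs_def by auto
  then show "c \<in> A" by simp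
  show "c + d \<in> leading_coeffs A t I k" if d: "d \<in> leading_coeffs A t I k" for d
  proof -
    obtain q where q: "d = coeff q k" "\<forall>i. coeff q i \<in> A" "\<forall>i>k. coeff q i = 0" "poly q t \<in> I"
      using d unfolding leading_coeffs_def by auto
    have "poly (p + q) t \<in> I" using p q I by (simp add: ideal_of_def)
    then show ?thesis
      unfolding leading_coeffs_def using p q closed_subringD[OF A]
      by (intro CollectI exI[of _ "p + q"]) auto
  qed
  show "a * c \<in> leading_coeffs A t I k" if a: "a \<in> A" for a
  proof -
    have "poly (Polynomial.smult a p) t \<in> I"
      using p I a subset_adjoin(1)[OF A, of t] by (auto simp: ideal_of_def)
    then show ?thesis
      unfolding leading_coeffs_def using p a closed_subringD[OF A]
      by (intro CollectI exI[of _ "Polynomial.smult a p"]) auto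
  qed
qed

text \<open>Multiplication by \<open>t\<close> raises the degree and keeps the leading coefficient.\<close>

lemma leading_coeffs_Suc:
  assumes A: "closed_subring A" and I: "ideal_of (adjoin A t) I"
  shows "leading_coeffs A t I k \<subseteq> leading_coeffs A t I (Suc k)"
proof
  fix c assume "c \<in> leading_coeffs A t I k"
  then obtain p where p: "c = coeff p k" "\<forall>i. coeff p i \<in> A" "\<forall>i>k. coeff p i = 0" "poly p t \<in> I"
    unfolding leading_coeffs_def by auto
  have "poly (pCons 0 p) t \<in> I"
    using p I subset_adjoin(2)[OF A, of t] by (auto simp: ideal_of_def)
  then show "c \<in> leading_coeffs A t I (Suc k)"
    unfolding leading_coeffs_def using p closed_subringD(1)[OF A]
    by (intro CollectI exI[of _ "pCons 0 p"]) (auto simp: coeff_pCons split: nat.splits)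
qed

text \<open>An element of \<open>J\<close> is reduced to one of smaller degree by subtracting an element of \<open>I\<close> with the
  same leading coefficient; after finitely many steps nothing is left.\<close>

lemma ideal_eqI_leading_coeffs:
  assumes A: "closed_subring A"
    and I: "ideal_of (adjoin A t) I" and J: "ideal_of (adjoin A t) J" and "I \<subseteq> J"
    and lc: "\<And>k. leading_coeffs A t J k = leading_coeffs A t I k"
  shows "J = I"
proof -
  have *: "poly p t \<in> I" if "\<forall>i. coeff p i \<in> A" "\<forall>i\<ge>k. coeff p i = 0" "poly p t \<in> J" for p k
    using that
  proof (induction k arbitrary: p)
    case 0
    then have "p = 0" by (simp add: poly_eq_iff)
    then show ?case using I by (simp add: ideal_of_def)
  next
    case (Suc k)
    then have "coeff p k \<in> leading_coeffs A t J k"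
      unfolding leading_coeffs_def by (auto simp: Suc_le_eq)
    then obtain q where q: "coeff p k = coeff q k" "\<forall>i. coeff q i \<in> A" "\<forall>i>k. coeff q i = 0"
        "poly q t \<in> I"
      unfolding lc unfolding leading_coeffs_def by auto
    \<comment> \<open>Ideals are closed under sums and multiples, so differences need the scalar \<open>- 1\<close>.\<close>
    have "- 1 \<in> adjoin A t"
      using closed_subringD(2,5)[OF closed_subring_adjoin[OF A]] by blast
    then have "- 1 * poly q t \<in> J" using q \<open>I \<subseteq> J\<close> J unfolding ideal_of_def by blast
    then have "poly p t + - 1 * poly q t \<in> J"
      using Suc.prems(3) J unfolding ideal_of_def by blast
    then have "poly (p - q) t \<in> J" by simp
    moreover have "coeff (p - q) i = 0" if "i \<ge> k" for i
      using that q Suc.prems(2) by (cases "i = k") auto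
    moreover have "\<forall>i. coeff (p - q) i \<in> A"
      using Suc.prems(1) q(2) closed_subringD(6)[OF A] by simp
    ultimately have "poly (p - q) t \<in> I" by (intro Suc.IH) auto
    then have "poly (p - q) t + poly q t \<in> I" using q(4) I unfolding ideal_of_def by blast
    then show ?case by simp
  qed
  have "poly p t \<in> I" if "\<forall>i. coeff p i \<in> A" "poly p t \<in> J" for p
    using *[of p "Suc (degree p)"] that by (simp add: Suc_le_eq coeff_eq_0)
  then have "J \<subseteq> I"
    using J unfolding ideal_of_def adjoin_def by auto
  with \<open>I \<subseteq> J\<close> show ?thesis by blast
qed

text \<open>For a chain \<open>I j\<close> of ideals of \<open>A[t]\<close> the ideals of leading coefficients increase both with \<open>j\<close> and
  with the degree \<open>k\<close>. The diagonal \<open>j = k\<close> becomes constant at some \<open>d\<close>, which settles all degrees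
  \<open>k \<ge> d\<close> at once; the finitely many smaller degrees are chains of their own.\<close>

theorem noetherian_adjoin:
  assumes A: "closed_subring A" and noeth: "noetherian A"
  shows "noetherian (adjoin A t)"
  unfolding noetherian_def
proof (intro allI impI)
  fix I assume I: "\<forall>j. ideal_of (adjoin A t) (I j)" and inc: "incseq I"
  let ?L = "\<lambda>j k. leading_coeffs A t (I j) k"
  have mono: "?L j k \<subseteq> ?L j' k'" if "j \<le> j'" "k \<le> k'" for j j' k k'
  proof -
    have "?L j k \<subseteq> ?L j' k"
      unfolding leading_coeffs_def using subsetD[OF incseqD[OF inc that(1)]]
      by (intro Collect_mono) blast
    also have "\<dots> \<subseteq> ?L j' k'"
      by (rule lift_Suc_mono_le[of "?L j'", OF leading_coeffs_Suc[OF A I[rule_format]] that(2)])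
    finally show ?thesis .
  qed
  have ideal: "ideal_of A (?L j k)" for j k
    using ideal_of_leading_coeffs[OF A] I by blast
  have stable: "\<exists>m. \<forall>j\<ge>m. K j = K m" if "\<And>j. ideal_of A (K j)" "incseq K" for K
    using noeth that unfolding noetherian_def by blast
  have "incseq (\<lambda>j. ?L j j)" by (intro incseq_SucI mono) auto
  from stable[OF ideal this] obtain d where d: "\<And>j. j \<ge> d \<Longrightarrow> ?L j j = ?L d d" by auto
  have "incseq (\<lambda>j. ?L j k)" for k by (intro incseq_SucI mono) auto
  from stable[OF ideal this] have "\<forall>k. \<exists>m. \<forall>j\<ge>m. ?L j k = ?L m k" by auto
  then obtain e where e: "\<forall>k. \<forall>j\<ge>e k. ?L j k = ?L (e k) k" by (rule choice[THEN exE])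
  define m where "m = Max (insert d (e ` {..d}))"
  have m: "d \<le> m" "\<And>k. k \<le> d \<Longrightarrow> e k \<le> m"
    unfolding m_def by (rule Max_ge; simp)+
  have same: "?L j k = ?L m k" if "j \<ge> m" for j k
  proof (cases "k \<le> d")
    case True
    then have "e k \<le> m" "e k \<le> j" using m(2)[of k] that by auto
    then have "?L j k = ?L (e k) k" "?L m k = ?L (e k) k" using e by blast+
    then show ?thesis by simp
  next
    case False
    have eq: "?L i k = ?L d d" if "i \<ge> d" for i
      using mono[of d i d k] mono[of i "max i k" k "max i k"] d[of "max i k"] that False by fastforce
    have "j \<ge> d" "m \<ge> d" using that m(1) by auto
    then show ?thesis by (simp only: eq)
  qed
  have "I j = I m" if "j \<ge> m" for j
    by (rule ideal_eqI_leading_coeffs[OF A I[rule_format] I[rule_format] incseqD[OF inc that]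
          same[OF that]])
  then show "\<exists>m. \<forall>j\<ge>m. I j = I m" by blast
qed

lemma closed_subring_function_algebra:
  assumes F: "complex_subfield F"
  shows "closed_subring (function_algebra F G)"
  using function_algebra.const[OF complex_subfield_closed(2)[OF F], of G]
    function_algebra_diff[OF F] function_algebra.mult
  unfolding closed_subring_def by (auto simp: one_fun_def fun_diff_def times_fun_def)

lemma function_algebra_insert:
  assumes F: "complex_subfield F"
  shows "function_algebra F (insert t G) = adjoin (function_algebra F G) t"
proof
  note sub = closed_subring_function_algebra[OF F]
  have sub': "closed_subring (adjoin (function_algebra F G) t)"
    by (rule closed_subring_adjoin[OF sub])
  show "function_algebra F (insert t G) \<subseteq> adjoin (function_algebra F G) t"
  proof
    fix f assume "f \<in> function_algebra F (insert t G)"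
    then show "f \<in> adjoin (function_algebra F G) t"
    proof induction
      case (add f g)
      then show ?case using closed_subringD(3)[OF sub'] by (auto simp: plus_fun_def)
    next
      case (mult f g)
      then show ?case using closed_subringD(4)[OF sub'] by (auto simp: times_fun_def)
    qed (use subset_adjoin[OF sub[of G]] in \<open>auto intro: function_algebra.intros\<close>)
  qed
  show "adjoin (function_algebra F G) t \<subseteq> function_algebra F (insert t G)"
  proof
    fix f assume "f \<in> adjoin (function_algebra F G) t"
    then obtain p where p: "f = poly p t" "\<forall>i. coeff p i \<in> function_algebra F G"
      unfolding adjoin_def by auto
    have "function_algebra F G \<subseteq> function_algebra F (insert t G)"
    proof
      fix f assume "f \<in> function_algebra F G"
      then show "f \<in> function_algebra F (insert t G)"
        by induction (auto intro: function_algebra.intros)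
    qed
    moreover have pow: "t ^ i \<in> function_algebra F (insert t G)" for i
    proof (induction i)
      case 0
      show ?case unfolding power_0 by (rule closed_subringD(2)[OF sub])
    next
      case (Suc i)
      show ?case
        unfolding power_Suc 
        by (rule closed_subringD(4)[OF sub function_algebra.gen[OF insertI1] Suc])
    qed
    ultimately show "f \<in> function_algebra F (insert t G)"
      unfolding p(1) poly_altdef using p(2)
      by (intro closed_subring_sum[OF sub] closed_subringD(4)[OF sub]) auto
  qed
qed

text \<open>The constants form a field, so the only ideals are zero and the whole ring.\<close>

lemma noetherian_constants:
  assumes F: "complex_subfield F"
  shows "noetherian (function_algebra F {} :: ('a \<Rightarrow> complex) set)"
proof -
  have const: "\<exists>c\<in>F. f = (\<lambda>_. c)" if "f \<in> function_algebra F {}" for f :: "'a \<Rightarrow> complex"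
    using that by induction (use complex_subfield_closed[OF F] in auto)
  have unit: "I = function_algebra F {}"
    if I: "ideal_of (function_algebra F {}) I" and "f \<in> I" "f \<noteq> 0" for I and f :: "'a \<Rightarrow> complex"
  proof
    show "I \<subseteq> function_algebra F {}" using I by (simp add: ideal_of_def)
    obtain c where c: "c \<in> F" "f = (\<lambda>_. c)"
      using const I \<open>f \<in> I\<close> unfolding ideal_of_def by blast
    with \<open>f \<noteq> 0\<close> have "c \<noteq> 0" by (auto simp: zero_fun_def)
    show "function_algebra F {} \<subseteq> I"
    proof
      fix g :: "'a \<Rightarrow> complex" assume "g \<in> function_algebra F {}"
      then obtain b where b: "b \<in> F" "g = (\<lambda>_. b)" using const by blast
      have "(\<lambda>_. b / c) * f \<in> I"
        using I \<open>f \<in> I\<close> function_algebra.const[OF complex_subfield_closed(8)[OF F b(1) c(1)], of "{}"]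
        unfolding ideal_of_def by blast
      moreover have "(\<lambda>_. b / c) * f = g" using c b \<open>c \<noteq> 0\<close> by (simp add: fun_eq_iff)
      ultimately show "g \<in> I" by simp
    qed
  qed
  show ?thesis
    unfolding noetherian_def
  proof (intro allI impI)
    fix I :: "nat \<Rightarrow> ('a \<Rightarrow> complex) set"
    assume I: "\<forall>j. ideal_of (function_algebra F {}) (I j)" and inc: "incseq I"
    show "\<exists>m. \<forall>j\<ge>m. I j = I m"
    proof (cases "\<exists>m. \<exists>f\<in>I m. f \<noteq> 0")
      case True
      then obtain m f where "f \<in> I m" "f \<noteq> 0" by blast
      then have "I j = function_algebra F {}" if "j \<ge> m" for j
        using unit I incseqD[OF inc that] by blast
      then show ?thesis by (intro exI[of _ m]) simp
    next
      case False
      then have "I j = {0}" for j using I unfolding ideal_of_def by auto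
      then show ?thesis by simp
    qed
  qed
qed

theorem noetherian_function_algebra:
  assumes F: "complex_subfield F" and "finite G"
  shows "noetherian (function_algebra F G)"
  using \<open>finite G\<close>
proof induction
  case empty
  show ?case by (rule noetherian_constants[OF F])
next
  case (insert t G)
  then show ?case
    unfolding function_algebra_insert[OF F]
    by (intro noetherian_adjoin closed_subring_function_algebra[OF F])
qed

text \<open>Otherwise equations from \<open>S\<close> could be added one by one, each cutting the zero set properly, and the
  ideals of functions vanishing on these zero sets would form a strictly increasing chain.\<close>

corollary finitely_many_equations:
  fixes G :: "('a \<Rightarrow> complex) set"
  assumes F: "complex_subfield F" and "finite G" and S: "S \<subseteq> function_algebra F G"
  shows "\<exists>T\<subseteq>S. finite T \<and> (\<forall>x. (\<forall>f\<in>T. f x = 0) \<longrightarrow> (\<forall>f\<in>S. f x = 0))"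
proof (rule ccontr)
  assume none: "\<not> ?thesis"
  define Z where "Z T = {x. \<forall>f\<in>T. f x = 0}" for T :: "('a \<Rightarrow> complex) set"
  define e where "e T = (SOME f. f \<in> S \<and> (\<exists>x\<in>Z T. f x \<noteq> 0))" for T :: "('a \<Rightarrow> complex) set"
  have e: "e T \<in> S \<and> (\<exists>x\<in>Z T. e T x \<noteq> 0)" if "T \<subseteq> S" "finite T" for T
  proof -
    have "\<not> (\<forall>x. (\<forall>f\<in>T. f x = 0) \<longrightarrow> (\<forall>f\<in>S. f x = 0))"
      using none that by blast
    then have ex: "\<exists>f. f \<in> S \<and> (\<exists>x\<in>Z T. f x \<noteq> 0)" unfolding Z_def by auto
    show ?thesis using someI_ex[OF ex] unfolding e_def .
  qed
  define T where "T = rec_nat {} (\<lambda>_ T. insert (e T) T)"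
  have T_Suc: "T (Suc j) = insert (e (T j)) (T j)" for j by (simp add: T_def)
  have T: "T j \<subseteq> S \<and> finite (T j)" for j
  proof (induction j)
    case (Suc j)
    then show ?case using e[of "T j"] by (simp add: T_Suc)
  qed (simp add: T_def)
  define I where "I j = {f \<in> function_algebra F G. \<forall>x\<in>Z (T j). f x = 0}" for j
  have "ideal_of (function_algebra F G) (I j)" for j
    using closed_subringD[OF closed_subring_function_algebra[OF F, of G]]
    unfolding ideal_of_def I_def by auto
  moreover have "incseq I"
    by (rule incseq_SucI) (auto simp: I_def Z_def T_Suc)
  ultimately have "\<exists>m. \<forall>j\<ge>m. I j = I m"
    using noetherian_function_algebra[OF F \<open>finite G\<close>] unfolding noetherian_def by blast
  then obtain m where "I (Suc m) = I m" using le_SucI[OF order_refl] by blast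
  moreover have "e (T m) \<in> I (Suc m)"
    using e[of "T m"] T[of m] S unfolding I_def by (auto simp: Z_def T_Suc)
  ultimately show False
    using e[of "T m"] T[of m] unfolding I_def by auto
qed


section \<open>Unordered pairs of points\<close>

definition index_pairs :: "nat \<Rightarrow> (nat \<times> nat) list" where
  "index_pairs n = [(i, j). i \<leftarrow> [0..<n], j \<leftarrow> [Suc i..<n]]"

definition symmetric_coords :: "nat \<Rightarrow> complex vec \<Rightarrow> complex vec \<Rightarrow> complex vec" where
  "symmetric_coords n x z = vec_of_list (
     map (\<lambda>j. x $ j + z $ j) [0..<n] @
     map (\<lambda>j. x $ j * z $ j) [0..<n] @
     map (\<lambda>(i, j). x $ i * x $ j + z $ i * z $ j) (index_pairs n))"

abbreviation symmetric_dim :: "nat \<Rightarrow> nat" where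
  "symmetric_dim n \<equiv> (n\<^sup>2 + 3 * n) div 2"

lemma R_map_eq_symmetric_coords: "R_map n L x = symmetric_coords n x (conj_map (L x))"
  unfolding R_map_def symmetric_coords_def index_pairs_def Let_def
  by (simp add: map_concat comp_def)

lemma symmetric_coords_carrier [simp]:
  "symmetric_coords n x z \<in> carrier_vec (symmetric_dim n)"
  using R_map_carrier[of n "\<lambda>_. conj_map z" x] by (simp add: R_map_eq_symmetric_coords)

lemma dim_symmetric_coords: "dim_vec (symmetric_coords n x z) = symmetric_dim n"
  by (rule carrier_vecD[OF symmetric_coords_carrier])

lemma set_index_pairs: "set (index_pairs n) = {(i, j). i < j \<and> j < n}"
  by (force simp: index_pairs_def image_iff)

lemma distinct_index_pairs: "distinct (index_pairs n)"
proof -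
  have "distinct (concat (map (\<lambda>i. map (Pair i) [Suc i..<n]) is))" if "distinct is" for "is"
    using that by (induction "is") (auto simp: distinct_map inj_on_def)
  then show ?thesis by (simp add: index_pairs_def)
qed

lemma symmetric_dim_eq: "symmetric_dim n = 2 * n + length (index_pairs n)"
  using dim_symmetric_coords[of n "0\<^sub>v n" "0\<^sub>v n"] by (simp add: symmetric_coords_def)

lemma symmetric_dim_cases:
  assumes "k < symmetric_dim n"
  shows "k < n \<or> (\<exists>i<n. k = n + i) \<or> (\<exists>l<length (index_pairs n). k = 2 * n + l)"
  using assms unfolding symmetric_dim_eq by presburger

lemma symmetric_coords_index:
  shows "i < n \<Longrightarrow> symmetric_coords n x z $ i = x $ i + z $ i"
    and "i < n \<Longrightarrow> symmetric_coords n x z $ (n + i) = x $ i * z $ i"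
    and "l < length (index_pairs n) \<Longrightarrow> index_pairs n ! l = (i, j) \<Longrightarrow>
      symmetric_coords n x z $ (2 * n + l) = x $ i * x $ j + z $ i * z $ j"
  unfolding symmetric_coords_def by (simp_all add: vec_of_list_index nth_append)

lemma symmetric_coords_commute: "symmetric_coords n z x = symmetric_coords n x z"
  by (simp add: symmetric_coords_def add.commute mult.commute)

definition pair_index :: "nat \<Rightarrow> nat \<Rightarrow> nat \<Rightarrow> nat" where
  "pair_index n i j = (THE l. l < length (index_pairs n) \<and> index_pairs n ! l = (i, j))"

lemma pair_index_nth:
  assumes "l < length (index_pairs n)" "index_pairs n ! l = (i, j)"
  shows "pair_index n i j = l"
  unfolding pair_index_def
proof (rule the_equality)
  fix l' assume "l' < length (index_pairs n) \<and> index_pairs n ! l' = (i, j)"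
  then show "l' = l"
    using nth_eq_iff_index_eq[OF distinct_index_pairs, of l' n l] assms by simp
qed (use assms in simp)

lemma pair_index:
  assumes "i < j" "j < n"
  shows "pair_index n i j < length (index_pairs n)" "index_pairs n ! pair_index n i j = (i, j)"
proof -
  have "(i, j) \<in> set (index_pairs n)" using assms by (simp add: set_index_pairs)
  then obtain l where "l < length (index_pairs n)" "index_pairs n ! l = (i, j)"
    by (auto simp: in_set_conv_nth)
  with pair_index_nth[OF this]
  show "pair_index n i j < length (index_pairs n)" "index_pairs n ! pair_index n i j = (i, j)"
    by auto
qed

text \<open>The product \<open>(x\<^sub>i - z\<^sub>i) (x\<^sub>j - z\<^sub>j)\<close> as a polynomial in the symmetric coordinates: for \<open>i = j\<close> it
  is the discriminant \<open>(x\<^sub>i + z\<^sub>i)\<^sup>2 - 4 x\<^sub>i z\<^sub>i\<close>, and otherwise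
  \<open>2 (x\<^sub>i x\<^sub>j + z\<^sub>i z\<^sub>j) - (x\<^sub>i + z\<^sub>i) (x\<^sub>j + z\<^sub>j)\<close>.\<close>

definition diff_product :: "nat \<Rightarrow> nat \<Rightarrow> nat \<Rightarrow> complex vec \<Rightarrow> complex" where
  "diff_product n i j w = (if i = j then w $ i * w $ i - 4 * w $ (n + i)
     else 2 * w $ (2 * n + pair_index n (min i j) (max i j)) - w $ i * w $ j)"

lemma diff_product_commute: "diff_product n i j w = diff_product n j i w"
  by (simp add: diff_product_def min.commute max.commute mult.commute)

lemma diff_product_symmetric_coords:
  assumes "i < n" "j < n"
  shows "diff_product n i j (symmetric_coords n x z) = (x $ i - z $ i) * (x $ j - z $ j)"
proof -
  have less: "diff_product n i j (symmetric_coords n x z) = (x $ i - z $ i) * (x $ j - z $ j)"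
    if "i < j" "j < n" for i j
  proof -
    have "i < n" using that by simp
    then show ?thesis
      unfolding diff_product_def using that symmetric_coords_index(3)[OF pair_index[OF that], of x z]
        symmetric_coords_index(1)[of i n x z] symmetric_coords_index(1)[of j n x z]
      by (simp add: min_def max_def) (simp add: algebra_simps)
  qed
  consider "i < j" | "j < i" | "i = j" by linarith
  then show ?thesis
  proof cases
    case 2
    then show ?thesis
      using less[of j i] assms by (simp add: diff_product_commute[of n i j] mult.commute)
  next
    case 3
    then show ?thesis
      using assms by (simp add: diff_product_def symmetric_coords_index) (simp add: algebra_simps)
  qed (use less assms in auto)
qed

lemma polyfun_coord: "i < n \<Longrightarrow> (\<lambda>x. x $ i) \<in> polyfun F n"
  by (intro function_algebra.gen) auto

lemma diff_product_polyfun: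
  assumes F: "complex_subfield F" and "i < n" "j < n"
  shows "diff_product n i j \<in> polyfun F (symmetric_dim n)"
proof -
  have "pair_index n (min i j) (max i j) < length (index_pairs n)" if "i \<noteq> j"
    using that assms by (intro pair_index) (auto simp: min_def max_def)
  then show ?thesis
    unfolding diff_product_def[abs_def] using assms(2,3)
    by (cases "i = j")
      (auto simp: symmetric_dim_eq complex_subfield_closed[OF F] intro!: function_algebra_diff[OF F]
        function_algebra.mult function_algebra.const polyfun_coord)
qed

lemma sum_diff_eqD:
  fixes a b c d :: complex
  assumes "a + b = c + d" "a - b = c - d"
  shows "a = c \<and> b = d"
proof -
  have "2 * a = (a + b) + (a - b)" by simp
  also have "\<dots> = 2 * c" unfolding assms by simp
  finally have "a = c" by simp
  with assms(1) show ?thesis by simp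
qed

text \<open>The sums \<open>x\<^sub>i + z\<^sub>i\<close> are known, and the products of the differences determine the vector of
  differences \<open>x - z\<close> up to one common sign; changing that sign swaps \<open>x\<close> and \<open>z\<close>.\<close>

lemma symmetric_coords_eqD:
  assumes "x \<in> carrier_vec n" "z \<in> carrier_vec n" "x' \<in> carrier_vec n" "z' \<in> carrier_vec n"
    and eq: "symmetric_coords n x z = symmetric_coords n x' z'"
  shows "x = x' \<and> z = z' \<or> x = z' \<and> z = x'"
proof -
  have s: "x $ i + z $ i = x' $ i + z' $ i" if "i < n" for i
    using arg_cong[OF eq, of "\<lambda>w. w $ i"] that by (simp add: symmetric_coords_index)
  have d: "(x $ i - z $ i) * (x $ j - z $ j) = (x' $ i - z' $ i) * (x' $ j - z' $ j)"
    if "i < n" "j < n" for i j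
    using arg_cong[OF eq, of "diff_product n i j"] that by (simp add: diff_product_symmetric_coords)
  have "(\<forall>i<n. x $ i - z $ i = x' $ i - z' $ i) \<or> (\<forall>i<n. x $ i - z $ i = - (x' $ i - z' $ i))"
  proof (cases "\<exists>j<n. x $ j - z $ j \<noteq> 0")
    case True
    then obtain j where j: "j < n" "x $ j - z $ j \<noteq> 0" by blast
    have "x $ j - z $ j = x' $ j - z' $ j \<or> x $ j - z $ j = - (x' $ j - z' $ j)"
      using d[OF j(1) j(1)] by (simp add: square_eq_iff)
    then show ?thesis
    proof
      assume e: "x $ j - z $ j = x' $ j - z' $ j"
      have "x $ i - z $ i = x' $ i - z' $ i" if "i < n" for i
        using d[OF that j(1)] j(2) unfolding e by (metis mult_right_cancel)
      then show ?thesis by blast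
    next
      assume e: "x $ j - z $ j = - (x' $ j - z' $ j)"
      have "x $ i - z $ i = - (x' $ i - z' $ i)" if "i < n" for i
      proof -
        have "(x $ i - z $ i) * (x $ j - z $ j) = - (x' $ i - z' $ i) * (x $ j - z $ j)"
          unfolding d[OF that j(1)] unfolding e by (simp only: minus_mult_minus)
        then show ?thesis using j(2) by (metis mult_right_cancel)
      qed
      then show ?thesis by blast
    qed
  next
    case False
    have "x' $ i - z' $ i = 0" if "i < n" for i
      using d[OF that that] False that by auto
    then show ?thesis using False by auto
  qed
  then show ?thesis
  proof
    assume e: "\<forall>i<n. x $ i - z $ i = x' $ i - z' $ i"
    have "x $ i = x' $ i \<and> z $ i = z' $ i" if "i < n" for i
      using sum_diff_eqD[of "x $ i" "z $ i" "x' $ i" "z' $ i"] s[OF that] e that by simp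
    then show ?thesis using assms(1-4) by (intro disjI1 conjI eq_vecI) auto
  next
    assume e: "\<forall>i<n. x $ i - z $ i = - (x' $ i - z' $ i)"
    have "x $ i = z' $ i \<and> z $ i = x' $ i" if "i < n" for i
      using sum_diff_eqD[of "x $ i" "z $ i" "z' $ i" "x' $ i"] s[OF that] e that by simp
    then show ?thesis using assms(1-4) by (intro disjI2 conjI eq_vecI) auto
  qed
qed

text \<open>A nonzero entry of the matrix forces a nonzero diagonal entry \<open>D j j\<close>, and then
  \<open>d\<^sub>k = D k j / \<surd>(D j j)\<close> works.\<close>

lemma rank_one_symmetric_square:
  fixes D :: "nat \<Rightarrow> nat \<Rightarrow> complex"
  assumes sym: "\<And>i j. D i j = D j i"
    and rank: "\<And>i j k l. i < n \<Longrightarrow> j < n \<Longrightarrow> k < n \<Longrightarrow> l < n \<Longrightarrow> D i j * D k l = D i k * D j l"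
  shows "\<exists>d. \<forall>i<n. \<forall>j<n. d i * d j = D i j"
proof (cases "\<exists>i<n. \<exists>j<n. D i j \<noteq> 0")
  case True
  then obtain i j where ij: "i < n" "j < n" "D i j \<noteq> 0" by blast
  have "D i i * D j j = D i j * D i j" by (rule rank) (use ij in auto)
  then have "D j j \<noteq> 0" using ij(3) by auto
  define r where "r = csqrt (D j j)"
  have r: "r * r = D j j" "r \<noteq> 0"
    using power2_csqrt[of "D j j"] \<open>D j j \<noteq> 0\<close> by (auto simp: r_def power2_eq_square)
  have "(D k j / r) * (D l j / r) = D k l" if "k < n" "l < n" for k l
  proof -
    have "D k j * D l j = D k l * D j j"
      using rank[of k j l j] that ij by simp
    then show ?thesis using r \<open>D j j \<noteq> 0\<close> by (simp add: field_simps)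
  qed
  then show ?thesis by (intro exI[of _ "\<lambda>k. D k j / r"]) blast
qed (auto intro!: exI[of _ "\<lambda>_. 0"])

text \<open>Given \<open>d\<close> with \<open>d\<^sub>i d\<^sub>j\<close> equal to the prescribed products of differences, the points
  \<open>x = (s + d) / 2\<close> and \<open>z = (s - d) / 2\<close> have the required symmetric coordinates, where \<open>s\<close> consists of
  the first \<open>n\<close> coordinates of \<open>w\<close>.\<close>

lemma symmetric_coords_surj:
  assumes w: "w \<in> carrier_vec (symmetric_dim n)"
    and rank: "\<And>i j k l. i < n \<Longrightarrow> j < n \<Longrightarrow> k < n \<Longrightarrow> l < n \<Longrightarrow>
      diff_product n i j w * diff_product n k l w = diff_product n i k w * diff_product n j l w"
  shows "\<exists>x\<in>carrier_vec n. \<exists>z\<in>carrier_vec n. w = symmetric_coords n x z"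
proof -
  obtain d where d: "\<forall>i<n. \<forall>j<n. d i * d j = diff_product n i j w"
    using rank_one_symmetric_square[of "\<lambda>i j. diff_product n i j w" n] diff_product_commute rank
    by blast
  define x where "x = vec n (\<lambda>i. (w $ i + d i) / 2)"
  define z where "z = vec n (\<lambda>i. (w $ i - d i) / 2)"
  have "w $ k = symmetric_coords n x z $ k" if k: "k < symmetric_dim n" for k
  proof -
    consider "k < n" | i where "i < n" "k = n + i"
      | l where "l < length (index_pairs n)" "k = 2 * n + l"
      using symmetric_dim_cases[OF k] by blast
    then show ?thesis
    proof cases
      case 1
      then show ?thesis by (simp add: symmetric_coords_index x_def z_def field_simps)
    next
      case (2 i)
      have "d i * d i = w $ i * w $ i - 4 * w $ (n + i)"
        using d 2 by (simp add: diff_product_def)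
      then show ?thesis using 2 by (simp add: symmetric_coords_index x_def z_def) (simp add: field_simps)
    next
      case (3 l)
      obtain i j where ij: "index_pairs n ! l = (i, j)" by fastforce
      then have "i < j" "j < n"
        using nth_mem[OF 3(1)] by (auto simp: set_index_pairs)
      then have "d i * d j = 2 * w $ k - w $ i * w $ j"
        using d 3 pair_index_nth[OF 3(1) ij] by (simp add: diff_product_def min_def max_def)
      then have "w $ k = (w $ i * w $ j + d i * d j) / 2" by simp
      also have "\<dots> = (w $ i + d i) / 2 * ((w $ j + d j) / 2) + (w $ i - d i) / 2 * ((w $ j - d j) / 2)"
        by (simp add: field_simps)
      also have "\<dots> = symmetric_coords n x z $ k"
        using 3 ij \<open>i < j\<close> \<open>j < n\<close> by (simp add: symmetric_coords_index x_def z_def)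
      finally show ?thesis .
    qed
  qed
  then have "w = symmetric_coords n x z"
    using w by (intro eq_vecI) (simp_all only: carrier_vecD dim_symmetric_coords)
  moreover have "x \<in> carrier_vec n" "z \<in> carrier_vec n" by (simp_all add: x_def z_def)
  ultimately show ?thesis by blast
qed

section \<open>Polynomials in a pair of points\<close>

abbreviation pair_polyfun :: "complex set \<Rightarrow> nat \<Rightarrow> (complex vec \<times> complex vec \<Rightarrow> complex) set" where
  "pair_polyfun F n \<equiv> function_algebra F
     ((\<lambda>i p. fst p $ i) ` {..<n} \<union> (\<lambda>i p. snd p $ i) ` {..<n})"

text \<open>Let \<open>s = x + z\<close> and \<open>d = x - z\<close>. Functions of this form are closed under
  products because \<open>d\<^sub>i d\<^sub>j\<close> is again a polynomial in the symmetric coordinates, and they contain the coordinates \<open>x\<^sub>i = (s\<^sub>i + d\<^sub>i) / 2\<close> and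
  \<open>z\<^sub>i = (s\<^sub>i - d\<^sub>i) / 2\<close>. Swapping \<open>x\<close> and \<open>z\<close> changes the sign of the second summand only, so the
  decomposition splits \<open>h\<close> into its symmetric and its antisymmetric part.\<close>

lemma pair_polyfun_decomposition:
  assumes F: "complex_subfield F" and h: "h \<in> pair_polyfun F n"
  shows "\<exists>A B. A \<in> polyfun F (symmetric_dim n) \<and> (\<forall>i<n. B i \<in> polyfun F (symmetric_dim n)) \<and>
    (\<forall>x z. h (x, z) = A (symmetric_coords n x z) +
       (\<Sum>i<n. B i (symmetric_coords n x z) * (x $ i - z $ i)))"
  using h
proof induction
  case (const c)
  then show ?case
    by (intro exI[of _ "\<lambda>_. c"] exI[of _ "\<lambda>_ _. 0"])
      (auto intro!: function_algebra.const complex_subfield_closed[OF F])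
next
  case (gen g)
  then obtain i \<sigma> where i: "i < n" "\<sigma> \<in> {1, - 1}"
    and g: "\<forall>x z. g (x, z) = (x $ i + z $ i) / 2 + \<sigma> / 2 * (x $ i - z $ i)"
  proof (elim UnE imageE)
    fix i assume "g = (\<lambda>p. fst p $ i)" "i \<in> {..<n}"
    then show ?thesis using that[of i 1] by (simp add: field_simps)
  next
    fix i assume "g = (\<lambda>p. snd p $ i)" "i \<in> {..<n}"
    then show ?thesis using that[of i "- 1"] by (simp add: field_simps)
  qed
  have "(\<lambda>w. 1 / 2 * w $ i) \<in> polyfun F (symmetric_dim n)"
    using i(1) by (intro function_algebra.mult function_algebra.const polyfun_coord
        complex_subfield_closed[OF F]) (simp add: symmetric_dim_eq)
  moreover have "(\<lambda>_. if j = i then \<sigma> / 2 else 0) \<in> polyfun F (symmetric_dim n)" for j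
    using i(2) complex_subfield_closed[OF F] by (intro function_algebra.const) auto
  ultimately show ?case
    using i(1) g
    by (intro exI[of _ "\<lambda>w. 1 / 2 * w $ i"] exI[of _ "\<lambda>j _. if j = i then \<sigma> / 2 else 0"])
      (auto simp: symmetric_coords_index if_distrib[of "\<lambda>c. c * _"] sum.delta cong: if_cong)
next
  case (add f g)
  then obtain A B A' B' where
    AB: "A \<in> polyfun F (symmetric_dim n)" "\<forall>i<n. B i \<in> polyfun F (symmetric_dim n)"
      "\<forall>x z. f (x, z) = A (symmetric_coords n x z) +
         (\<Sum>i<n. B i (symmetric_coords n x z) * (x $ i - z $ i))"
    and AB': "A' \<in> polyfun F (symmetric_dim n)" "\<forall>i<n. B' i \<in> polyfun F (symmetric_dim n)"
      "\<forall>x z. g (x, z) = A' (symmetric_coords n x z) +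
         (\<Sum>i<n. B' i (symmetric_coords n x z) * (x $ i - z $ i))"
    by blast
  show ?case
  proof (intro exI conjI allI impI)
    show "(\<lambda>w. A w + A' w) \<in> polyfun F (symmetric_dim n)"
      using AB AB' by (intro function_algebra.add)
    show "(\<lambda>w. B i w + B' i w) \<in> polyfun F (symmetric_dim n)" if "i < n" for i
      using AB AB' that by (intro function_algebra.add) auto
  qed (use AB AB' in \<open>simp add: sum.distrib distrib_right\<close>)
next
  case (mult f g)
  then obtain A B A' B' where
    AB: "A \<in> polyfun F (symmetric_dim n)" "\<forall>i<n. B i \<in> polyfun F (symmetric_dim n)"
      "\<forall>x z. f (x, z) = A (symmetric_coords n x z) +
         (\<Sum>i<n. B i (symmetric_coords n x z) * (x $ i - z $ i))"
    and AB': "A' \<in> polyfun F (symmetric_dim n)" "\<forall>i<n. B' i \<in> polyfun F (symmetric_dim n)"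
      "\<forall>x z. g (x, z) = A' (symmetric_coords n x z) +
         (\<Sum>i<n. B' i (symmetric_coords n x z) * (x $ i - z $ i))"
    by blast
  show ?case
  proof (intro exI conjI allI impI)
    show "(\<lambda>w. A w * A' w + (\<Sum>i<n. \<Sum>j<n. B i w * B' j w * diff_product n i j w)) \<in>
        polyfun F (symmetric_dim n)"
      using AB AB' complex_subfield_closed(1)[OF F]
      by (intro function_algebra.add function_algebra.mult function_algebra_sum
          diff_product_polyfun[OF F]) auto
    show "(\<lambda>w. A w * B' i w + A' w * B i w) \<in> polyfun F (symmetric_dim n)" if "i < n" for i
      using AB AB' that by (intro function_algebra.add function_algebra.mult) auto
    fix x z
    let ?w = "symmetric_coords n x z" and ?d = "\<lambda>i. x $ i - z $ i"
    have "(\<Sum>i<n. B i ?w * ?d i) * (\<Sum>i<n. B' i ?w * ?d i) =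
        (\<Sum>i<n. \<Sum>j<n. B i ?w * B' j ?w * diff_product n i j ?w)"
      unfolding sum_product
      by (intro sum.cong refl) (simp add: diff_product_symmetric_coords mult_ac)
    then show "f (x, z) * g (x, z) =
        A ?w * A' ?w + (\<Sum>i<n. \<Sum>j<n. B i ?w * B' j ?w * diff_product n i j ?w) +
        (\<Sum>i<n. (A ?w * B' i ?w + A' ?w * B i ?w) * ?d i)"
      using AB(3) AB'(3)
      by (simp add: distrib_left distrib_right sum.distrib sum_distrib_left mult.assoc
          mult.commute mult.left_commute)
  qed
qed


lemma pair_polyfun_symmetrize:
  assumes F: "complex_subfield F" and h: "h \<in> pair_polyfun F n"
  shows "\<exists>A\<in>polyfun F (symmetric_dim n). \<forall>x z. h (x, z) + h (z, x) = A (symmetric_coords n x z)"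
proof -
  obtain A B where A: "A \<in> polyfun F (symmetric_dim n)"
    and h: "\<forall>x z. h (x, z) = A (symmetric_coords n x z) +
         (\<Sum>i<n. B i (symmetric_coords n x z) * (x $ i - z $ i))"
    using pair_polyfun_decomposition[OF F h] by blast
  have "h (x, z) + h (z, x) = 2 * A (symmetric_coords n x z)" for x z
    unfolding h[rule_format] symmetric_coords_commute[of n z x]
    by (simp add: right_diff_distrib sum_subtractf)
  moreover have "(\<lambda>w. 2 * A w) \<in> polyfun F (symmetric_dim n)"
    using A by (intro function_algebra.mult function_algebra.const complex_subfield_closed[OF F])
  ultimately show ?thesis by (intro bexI[of _ "\<lambda>w. 2 * A w"]) auto
qed

text \<open>With \<open>h = A + S\<close> split into its symmetric part \<open>A\<close> and its antisymmetric part \<open>S\<close>, the two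
  conditions say \<open>A = S = 0\<close>. Here \<open>S = \<Sum>\<^sub>i B\<^sub>i d\<^sub>i\<close> is in general no function of the symmetric
  coordinates, but all \<open>S d\<^sub>j\<close> are, and they vanish together exactly if \<open>S\<close> does: if every \<open>d\<^sub>j\<close> is zero, so is \<open>S\<close>.\<close>

lemma pair_polyfun_zero_iff:
  assumes F: "complex_subfield F" and h: "h \<in> pair_polyfun F n"
  shows "\<exists>E. finite E \<and> E \<subseteq> polyfun F (symmetric_dim n) \<and>
    (\<forall>x z. h (x, z) = 0 \<and> h (z, x) = 0 \<longleftrightarrow> (\<forall>e\<in>E. e (symmetric_coords n x z) = 0))"
proof -
  let ?w = "symmetric_coords n"
  obtain A B where A: "A \<in> polyfun F (symmetric_dim n)"
    and B: "\<forall>i<n. B i \<in> polyfun F (symmetric_dim n)"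
    and h: "\<forall>x z. h (x, z) = A (?w x z) + (\<Sum>i<n. B i (?w x z) * (x $ i - z $ i))"
    using pair_polyfun_decomposition[OF F h] by blast
  define C where "C j w = (\<Sum>i<n. B i w * diff_product n i j w)" for j w
  have C: "C j (?w x z) = (\<Sum>i<n. B i (?w x z) * (x $ i - z $ i)) * (x $ j - z $ j)"
    if "j < n" for j x z
    unfolding C_def sum_distrib_right using that
    by (intro sum.cong refl) (simp add: diff_product_symmetric_coords)
  have "h (x, z) = 0 \<and> h (z, x) = 0 \<longleftrightarrow> A (?w x z) = 0 \<and> (\<forall>j<n. C j (?w x z) = 0)" for x z
  proof -
    define S where "S = (\<Sum>i<n. B i (?w x z) * (x $ i - z $ i))"
    have "h (z, x) = A (?w x z) - S"
      unfolding h[rule_format] symmetric_coords_commute[of n z x] S_def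
      by (simp add: right_diff_distrib sum_subtractf)
    moreover have "h (x, z) = A (?w x z) + S" unfolding h[rule_format] S_def ..
    ultimately have "h (x, z) = 0 \<and> h (z, x) = 0 \<longleftrightarrow> A (?w x z) = 0 \<and> S = 0"
      by (auto simp: eq_neg_iff_add_eq_0[symmetric])
    also have "S = 0 \<longleftrightarrow> (\<forall>j<n. S * (x $ j - z $ j) = 0)"
    proof (rule iffI)
      assume *: "\<forall>j<n. S * (x $ j - z $ j) = 0"
      show "S = 0"
      proof (rule ccontr)
        assume "S \<noteq> 0"
        with * have "S = (\<Sum>i<n. B i (?w x z) * 0)" unfolding S_def by (intro sum.cong) auto
        with \<open>S \<noteq> 0\<close> show False by simp
      qed
    qed simp
    also have "(\<forall>j<n. S * (x $ j - z $ j) = 0) \<longleftrightarrow> (\<forall>j<n. C j (?w x z) = 0)"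
      using C[of _ x z] by (simp add: S_def)
    finally show ?thesis .
  qed
  moreover have "C j \<in> polyfun F (symmetric_dim n)" if "j < n" for j
    unfolding C_def[abs_def] using B that
    by (intro function_algebra_sum function_algebra.mult diff_product_polyfun[OF F]
        complex_subfield_closed(1)[OF F]) auto
  ultimately show ?thesis
    using A by (intro exI[of _ "insert A (C ` {..<n})"]) auto
qed

text \<open>The image consists of those \<open>w = \<Phi>(x, z)\<close> for which \<open>(x, z)\<close> or \<open>(z, x)\<close> lies in \<open>\<Gamma>\<close>. The first
  condition, that \<open>w\<close> is such a value at all, is the rank condition. The second is a union of two
  algebraic sets, described by products of equations, and becomes a condition on \<open>w\<close> by the
  preceding lemma.\<close>

theorem algebraic_image_symmetric_coords:
  assumes F: "complex_subfield F" and H: "finite H" "H \<subseteq> pair_polyfun F n"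
    and \<Gamma>: "\<Gamma> = {p \<in> carrier_vec n \<times> carrier_vec n. \<forall>h\<in>H. h p = 0}"
  shows "algebraic_set_over F (symmetric_dim n) ((\<lambda>(x, z). symmetric_coords n x z) ` \<Gamma>)"
proof -
  \<comment> \<open>The products \<open>h(x, z) h'(z, x)\<close> vanish simultaneously iff all \<open>h(x, z)\<close> or all \<open>h(z, x)\<close> vanish.\<close>
  define M where "M = (\<lambda>(h, h') p. h p * h' (prod.swap p)) ` (H \<times> H)"
  have swap: "(\<lambda>p. h (prod.swap p)) \<in> pair_polyfun F n" if "h \<in> pair_polyfun F n" for h
    by (rule function_algebra_compose[OF that]) (auto intro!: function_algebra.gen)
  define eqs where "eqs m E \<longleftrightarrow> finite E \<and> E \<subseteq> polyfun F (symmetric_dim n) \<and>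
      (\<forall>x z. m (x, z) = 0 \<and> m (z, x) = 0 \<longleftrightarrow> (\<forall>e\<in>E. e (symmetric_coords n x z) = 0))"
    for m :: "complex vec \<times> complex vec \<Rightarrow> complex" and E
  have "\<exists>E. eqs m E" if "m \<in> M" for m
    using that H(2) unfolding M_def eqs_def
    by (intro pair_polyfun_zero_iff[OF F]) (auto intro!: function_algebra.mult swap)
  then obtain E where E0: "\<forall>m\<in>M. eqs m (E m)" using bchoice[of M eqs] by blast
  have E: "finite (E m)" "E m \<subseteq> polyfun F (symmetric_dim n)"
      "m (x, z) = 0 \<and> m (z, x) = 0 \<longleftrightarrow> (\<forall>e\<in>E m. e (symmetric_coords n x z) = 0)"
    if "m \<in> M" for m x z
    using bspec[OF E0 that] unfolding eqs_def by simp_all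
  have M: "(\<forall>m\<in>M. m (x, z) = 0 \<and> m (z, x) = 0) \<longleftrightarrow> (x, z) \<in> \<Gamma> \<or> (z, x) \<in> \<Gamma>"
    if "x \<in> carrier_vec n" "z \<in> carrier_vec n" for x z
  proof -
    have "(\<forall>m\<in>M. m (x, z) = 0 \<and> m (z, x) = 0) \<longleftrightarrow>
        (\<forall>h\<in>H. \<forall>h'\<in>H. (h (x, z) = 0 \<or> h' (z, x) = 0) \<and> (h (z, x) = 0 \<or> h' (x, z) = 0))"
      unfolding M_def by simp
    also have "\<dots> \<longleftrightarrow> (\<forall>h\<in>H. h (x, z) = 0) \<or> (\<forall>h\<in>H. h (z, x) = 0)" by blast
    finally show ?thesis using that by (simp add: \<Gamma>)
  qed
  define P where "P = (\<lambda>(i, j, k, l) w. diff_product n i j w * diff_product n k l w -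
      diff_product n i k w * diff_product n j l w) ` ({..<n} \<times> {..<n} \<times> {..<n} \<times> {..<n})"
  have "(\<lambda>(x, z). symmetric_coords n x z) ` \<Gamma> =
      {w \<in> carrier_vec (symmetric_dim n). \<forall>e\<in>P \<union> \<Union>(E ` M). e w = 0}" (is "_ = ?Z")
  proof (intro equalityI subsetI)
    fix w assume "w \<in> (\<lambda>(x, z). symmetric_coords n x z) ` \<Gamma>"
    then obtain x z where xz: "(x, z) \<in> \<Gamma>" "w = symmetric_coords n x z" by auto
    then have carr: "x \<in> carrier_vec n" "z \<in> carrier_vec n" by (auto simp: \<Gamma>)
    have "e w = 0" if "e \<in> P" for e
      using that unfolding P_def xz(2) by (auto simp: diff_product_symmetric_coords)
    moreover have "e w = 0" if "m \<in> M" "e \<in> E m" for m e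
      using M[OF carr] xz E(3)[OF that(1), of x z] that by blast
    ultimately show "w \<in> ?Z" using xz(2) by auto
  next
    fix w assume w: "w \<in> ?Z"
    then have carr: "w \<in> carrier_vec (symmetric_dim n)"
      and zero: "\<And>e. e \<in> P \<union> \<Union>(E ` M) \<Longrightarrow> e w = 0" by auto
    have "diff_product n i j w * diff_product n k l w = diff_product n i k w * diff_product n j l w"
      if "i < n" "j < n" "k < n" "l < n" for i j k l
    proof -
      have "(\<lambda>w. diff_product n i j w * diff_product n k l w -
          diff_product n i k w * diff_product n j l w) \<in> P"
        unfolding P_def using that by (intro image_eqI[of _ _ "(i, j, k, l)"]) auto
      from zero[OF UnI1[OF this]] show ?thesis by simp
    qed
    then obtain x z where xz: "x \<in> carrier_vec n" "z \<in> carrier_vec n" "w = symmetric_coords n x z"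
      using symmetric_coords_surj[OF carr] by blast
    have "m (x, z) = 0 \<and> m (z, x) = 0" if "m \<in> M" for m
      using E(3)[OF that, of x z] zero that xz(3) by blast
    then have "(x, z) \<in> \<Gamma> \<or> (z, x) \<in> \<Gamma>" using M[OF xz(1,2)] by blast
    then show "w \<in> (\<lambda>(x, z). symmetric_coords n x z) ` \<Gamma>"
    proof
      assume "(x, z) \<in> \<Gamma>"
      then show ?thesis using xz(3) by (intro image_eqI[of _ _ "(x, z)"]) auto
    next
      assume "(z, x) \<in> \<Gamma>"
      then show ?thesis
        using xz(3) by (intro image_eqI[of _ _ "(z, x)"]) (auto simp: symmetric_coords_commute)
    qed
  qed
  moreover have "finite (P \<union> \<Union>(E ` M))"
    using H(1) E(1) by (auto simp: P_def M_def)
  moreover have "P \<union> \<Union>(E ` M) \<subseteq> polyfun F (symmetric_dim n)"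
    using E(2) by (auto simp: P_def intro!: function_algebra_diff[OF F] function_algebra.mult
        diff_product_polyfun[OF F])
  ultimately show ?thesis
    unfolding algebraic_set_over_iff_polyfun[OF F] by blast
qed

section \<open>Graphs of regular maps\<close>

text \<open>A local quotient \<open>T y $ i = f y / g y\<close> contributes the equation \<open>g(x) (g(x) z\<^sub>i - f(x)) = 0\<close>. The extra
  factor \<open>g\<close> makes it hold on the whole graph, also where \<open>g\<close> vanishes and \<open>f\<close> may not; where \<open>g\<close> is
  nonzero the equation determines \<open>z\<^sub>i\<close>. The denominators have no common zero on \<open>X\<close>, and finitely many
  of them already have this property.\<close>

lemma algebraic_graph:
  assumes F: "complex_subfield F" and X: "algebraic_set_over F n X"
    and T: "regular_map_over F n X n T"
  shows "\<exists>H. finite H \<and> H \<subseteq> pair_polyfun F n \<and>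
    (\<lambda>x. (x, T x)) ` X = {p \<in> carrier_vec n \<times> carrier_vec n. \<forall>h\<in>H. h p = 0}"
proof -
  obtain HX where HX: "finite HX" "HX \<subseteq> polyfun F n" "X = {x \<in> carrier_vec n. \<forall>h\<in>HX. h x = 0}"
    using X unfolding algebraic_set_over_iff_polyfun[OF F] by blast
  have T_carrier: "T x \<in> carrier_vec n" if "x \<in> X" for x
    using T that unfolding regular_map_over_def by blast
  define rep where
    "rep i g f \<longleftrightarrow> f \<in> polyfun F n \<and> (\<forall>y\<in>X. g y \<noteq> 0 \<longrightarrow> T y $ i = f y / g y)" for i g f
  \<comment> \<open>All denominators that represent the \<open>i\<close>-th coordinate of \<open>T\<close>; this set is infinite in general.\<close>
  define D where "D i = {g \<in> polyfun F n. \<exists>f. rep i g f}" for i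
  have "\<forall>i. \<exists>G. G \<subseteq> D i \<and> finite G \<and> (\<forall>x. (\<forall>g\<in>G. g x = 0) \<longrightarrow> (\<forall>g\<in>D i. g x = 0))"
  proof
    fix i
    have "D i \<subseteq> polyfun F n" unfolding D_def by blast
    then show "\<exists>G. G \<subseteq> D i \<and> finite G \<and> (\<forall>x. (\<forall>g\<in>G. g x = 0) \<longrightarrow> (\<forall>g\<in>D i. g x = 0))"
      by (intro finitely_many_equations[OF F, of "(\<lambda>i x. x $ i) ` {..<n}"]) simp_all
  qed
  from choice[OF this] obtain G where "\<forall>i. G i \<subseteq> D i \<and> finite (G i) \<and>
      (\<forall>x. (\<forall>g\<in>G i. g x = 0) \<longrightarrow> (\<forall>g\<in>D i. g x = 0))" ..
  then have G: "\<And>i. G i \<subseteq> D i" "\<And>i. finite (G i)"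
      "\<And>i x. \<forall>g\<in>G i. g x = 0 \<Longrightarrow> \<forall>g\<in>D i. g x = 0"
    by blast+
  have cover: "\<exists>g\<in>G i. g x \<noteq> 0" if "x \<in> X" "i < n" for i x
  proof -
    have "\<exists>g\<in>D i. g x \<noteq> 0"
      using T that unfolding regular_map_over_iff_polyfun[OF F] D_def rep_def by blast
    then show ?thesis using G(3) by blast
  qed
  define num where "num i g = (SOME f. rep i g f)" for i g
  have num: "rep i g (num i g)" if "g \<in> G i" for i g
  proof -
    have "\<exists>f. rep i g f" using subsetD[OF G(1) that] unfolding D_def by blast
    then show ?thesis unfolding num_def by (rule someI_ex)
  qed
  define e where "e i g p = g (fst p) * (g (fst p) * snd p $ i - num i g (fst p))"
    for i and g :: "complex vec \<Rightarrow> complex" and p :: "complex vec \<times> complex vec"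
  define H where "H = (\<lambda>h p. h (fst p)) ` HX \<union> (\<Union>i<n. e i ` G i)"
  have "(\<lambda>x. (x, T x)) ` X = {p \<in> carrier_vec n \<times> carrier_vec n. \<forall>h\<in>H. h p = 0}"
  proof (intro equalityI subsetI)
    fix p assume "p \<in> (\<lambda>x. (x, T x)) ` X"
    then obtain x where x: "x \<in> X" "p = (x, T x)" by blast
    have "e i g p = 0" if "g \<in> G i" for i g
      using num[OF that] x unfolding rep_def e_def by (cases "g x = 0") auto
    then show "p \<in> {p \<in> carrier_vec n \<times> carrier_vec n. \<forall>h\<in>H. h p = 0}"
      using x T_carrier[OF x(1)] HX(3) by (auto simp: H_def)
  next
    fix p assume p: "p \<in> {p \<in> carrier_vec n \<times> carrier_vec n. \<forall>h\<in>H. h p = 0}"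
    obtain x z where xz: "p = (x, z)" by fastforce
    have carr: "x \<in> carrier_vec n" "z \<in> carrier_vec n" and zero: "\<forall>h\<in>H. h (x, z) = 0"
      using p xz by auto
    have "h x = 0" if "h \<in> HX" for h
      using bspec[OF zero, of "\<lambda>p. h (fst p)"] that by (simp add: H_def)
    then have x: "x \<in> X" using carr HX(3) by simp
    have "z $ i = T x $ i" if i: "i < n" for i
    proof -
      obtain g where g: "g \<in> G i" "g x \<noteq> 0" using cover[OF x i] by blast
      then have "e i g (x, z) = 0" using zero i by (auto simp: H_def)
      then have "g x * z $ i = num i g x" using g(2) by (simp add: e_def)
      then have "z $ i = num i g x / g x" using g(2) by (simp add: field_simps)
      moreover have "T x $ i = num i g x / g x" using num[OF g(1)] g(2) x by (simp add: rep_def)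
      ultimately show ?thesis by simp
    qed
    then have "z = T x" using carr T_carrier[OF x] by (intro eq_vecI) auto
    then show "p \<in> (\<lambda>x. (x, T x)) ` X" using x xz by blast
  qed
  moreover have "finite H" using HX(1) G(2) by (auto simp: H_def)
  moreover have "H \<subseteq> pair_polyfun F n"
  proof -
    have fst: "(\<lambda>p. f (fst p)) \<in> pair_polyfun F n" if "f \<in> polyfun F n" for f
      by (rule function_algebra_compose[OF that]) (auto intro!: function_algebra.gen)
    have "e i g \<in> pair_polyfun F n" if "g \<in> G i" "i < n" for i g
    proof -
      have "g \<in> polyfun F n" "num i g \<in> polyfun F n"
        using that num[of g i] G(1)[of i] by (auto simp: D_def rep_def)
      moreover have "(\<lambda>p. snd p $ i) \<in> pair_polyfun F n"
        using that by (intro function_algebra.gen) auto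
      ultimately show ?thesis
        unfolding e_def[abs_def]
        by (intro function_algebra_diff[OF F] function_algebra.mult fst)
    qed
    then show ?thesis using HX(2) fst by (auto simp: H_def)
  qed
  ultimately show ?thesis by blast
qed

text \<open>Along the graph of a regular map, a polynomial in \<open>(x, z)\<close> becomes a regular function of \<open>x\<close>:
  quotients are added and multiplied with the product of the denominators as new denominator.\<close>

lemma regular_on_graph:
  assumes F: "complex_subfield F" and h: "h \<in> pair_polyfun F n"
    and T: "regular_map_over F n X n T" and x: "x \<in> X"
  shows "\<exists>f\<in>polyfun F n. \<exists>g\<in>polyfun F n. g x \<noteq> 0 \<and> (\<forall>y\<in>X. g y \<noteq> 0 \<longrightarrow> h (y, T y) = f y / g y)"
  using h
proof induction
  case (const c)
  then show ?case
    by (intro bexI[of _ "\<lambda>_. c"] bexI[of _ "\<lambda>_. 1"])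
      (auto intro!: function_algebra.const complex_subfield_closed[OF F])
next
  case (gen g)
  then consider i where "i < n" "g = (\<lambda>p. fst p $ i)" | i where "i < n" "g = (\<lambda>p. snd p $ i)" by auto
  then show ?case
  proof cases
    case 1
    then show ?thesis
      by (intro bexI[of _ "\<lambda>x. x $ i"] bexI[of _ "\<lambda>_. 1"])
        (auto intro!: function_algebra.const polyfun_coord complex_subfield_closed[OF F])
  next
    case 2
    then show ?thesis using T x unfolding regular_map_over_iff_polyfun[OF F] by auto
  qed
next
  case (add h h')
  then obtain f g f' g' where fg: "f \<in> polyfun F n" "g \<in> polyfun F n" "g x \<noteq> 0"
      "\<forall>y\<in>X. g y \<noteq> 0 \<longrightarrow> h (y, T y) = f y / g y"
    and fg': "f' \<in> polyfun F n" "g' \<in> polyfun F n" "g' x \<noteq> 0"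
      "\<forall>y\<in>X. g' y \<noteq> 0 \<longrightarrow> h' (y, T y) = f' y / g' y" by blast
  show ?case
  proof (rule bexI[of _ "\<lambda>y. f y * g' y + f' y * g y"], rule bexI[of _ "\<lambda>y. g y * g' y"],
      intro conjI ballI impI)
    show "(\<lambda>y. f y * g' y + f' y * g y) \<in> polyfun F n" "(\<lambda>y. g y * g' y) \<in> polyfun F n"
      using fg fg' by (auto intro!: function_algebra.add function_algebra.mult)
    show "g x * g' x \<noteq> 0" using fg fg' by simp
    fix y assume "y \<in> X" "g y * g' y \<noteq> 0"
    then show "h (y, T y) + h' (y, T y) = (f y * g' y + f' y * g y) / (g y * g' y)"
      using fg(4) fg'(4) by (simp add: add_frac_eq)
  qed
next
  case (mult h h')
  then obtain f g f' g' where fg: "f \<in> polyfun F n" "g \<in> polyfun F n" "g x \<noteq> 0"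
      "\<forall>y\<in>X. g y \<noteq> 0 \<longrightarrow> h (y, T y) = f y / g y"
    and fg': "f' \<in> polyfun F n" "g' \<in> polyfun F n" "g' x \<noteq> 0"
      "\<forall>y\<in>X. g' y \<noteq> 0 \<longrightarrow> h' (y, T y) = f' y / g' y" by blast
  show ?case
  proof (rule bexI[of _ "\<lambda>y. f y * f' y"], rule bexI[of _ "\<lambda>y. g y * g' y"],
      intro conjI ballI impI)
    show "(\<lambda>y. f y * f' y) \<in> polyfun F n" "(\<lambda>y. g y * g' y) \<in> polyfun F n"
      using fg fg' by (auto intro!: function_algebra.mult)
    show "g x * g' x \<noteq> 0" using fg fg' by simp
    fix y assume "y \<in> X" "g y * g' y \<noteq> 0"
    then show "h (y, T y) * h' (y, T y) = (f y * f' y) / (g y * g' y)"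
      using fg(4) fg'(4) by simp
  qed
qed

lemma symmetric_coords_pair_polyfun:
  assumes F: "complex_subfield F" and k: "k < symmetric_dim n"
  shows "(\<lambda>p. symmetric_coords n (fst p) (snd p) $ k) \<in> pair_polyfun F n"
proof -
  have coord: "(\<lambda>p. fst p $ i) \<in> pair_polyfun F n" "(\<lambda>p. snd p $ i) \<in> pair_polyfun F n"
    if "i < n" for i
    using that by (auto intro!: function_algebra.gen)
  consider "k < n" | i where "i < n" "k = n + i" | l where "l < length (index_pairs n)" "k = 2 * n + l"
    using symmetric_dim_cases[OF k] by blast
  then show ?thesis
  proof cases
    case (3 l)
    obtain i j where ij: "index_pairs n ! l = (i, j)" by fastforce
    then have "i < n" "j < n" using nth_mem[OF 3(1)] by (auto simp: set_index_pairs)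
    have "(\<lambda>p. symmetric_coords n (fst p) (snd p) $ k) =
        (\<lambda>p. fst p $ i * fst p $ j + snd p $ i * snd p $ j)"
      unfolding 3(2) symmetric_coords_index(3)[OF 3(1) ij] ..
    then show ?thesis
      using \<open>i < n\<close> \<open>j < n\<close>
      by (simp only:) (intro function_algebra.add function_algebra.mult coord)
  next
    case 1
    show ?thesis
      unfolding symmetric_coords_index(1)[OF 1] by (intro function_algebra.add coord 1)
  next
    case (2 i)
    show ?thesis
      unfolding 2(2) symmetric_coords_index(2)[OF 2(1)] by (intro function_algebra.mult coord 2)
  qed
qed

section \<open>Complex conjugation and descent\<close>

lemma conj_map_carrier [simp]: "conj_map x \<in> carrier_vec n \<longleftrightarrow> x \<in> carrier_vec n"
  unfolding carrier_dim_vec conj_map_def by simp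

lemma conj_map_index: "x \<in> carrier_vec n \<Longrightarrow> i < n \<Longrightarrow> conj_map x $ i = cnj (x $ i)"
  unfolding carrier_dim_vec conj_map_def by simp

lemma conj_map_symmetric_coords:
  assumes "x \<in> carrier_vec n" "z \<in> carrier_vec n"
  shows "conj_map (symmetric_coords n x z) = symmetric_coords n (conj_map x) (conj_map z)"
proof (rule eq_vecI)
  fix k assume "k < dim_vec (symmetric_coords n (conj_map x) (conj_map z))"
  then have k: "k < symmetric_dim n"
    by (simp only: dim_symmetric_coords)
  consider "k < n" | i where "i < n" "k = n + i" | l where "l < length (index_pairs n)" "k = 2 * n + l"
    using symmetric_dim_cases[OF k] by blast
  then show "conj_map (symmetric_coords n x z) $ k =
      symmetric_coords n (conj_map x) (conj_map z) $ k"
  proof cases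
    case (3 l)
    obtain i j where ij: "index_pairs n ! l = (i, j)" by fastforce
    then have "i < n" "j < n" using nth_mem[OF 3(1)] by (auto simp: set_index_pairs)
    then show ?thesis
      using 3 ij assms k
      by (simp add: symmetric_coords_index conj_map_index[OF symmetric_coords_carrier]
          conj_map_index[of _ n])
  qed (use assms k in \<open>simp_all add: symmetric_coords_index
        conj_map_index[OF symmetric_coords_carrier] conj_map_index[of _ n]\<close>)
qed (simp only: conj_map_def dim_symmetric_coords index_map_vec)

lemma polyfun_conjugate:
  assumes "f \<in> polyfun F n"
  shows "\<exists>g\<in>polyfun (cnj ` F) n. \<forall>x\<in>carrier_vec n. g x = cnj (f (conj_map x))"
  using assms
proof induction
  case (const c)
  then show ?case by (intro bexI[of _ "\<lambda>_. cnj c"]) (auto intro: function_algebra.const)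
next
  case (gen g)
  then obtain i where "i < n" "g = (\<lambda>x. x $ i)" by auto
  then show ?case by (intro bexI[of _ "\<lambda>x. x $ i"] polyfun_coord) (auto simp: conj_map_index)
next
  case (add f g)
  then obtain f' g' where "f' \<in> polyfun (cnj ` F) n" "g' \<in> polyfun (cnj ` F) n"
    "\<forall>x\<in>carrier_vec n. f' x = cnj (f (conj_map x))" "\<forall>x\<in>carrier_vec n. g' x = cnj (g (conj_map x))"
    by blast
  then show ?case
    by (intro bexI[of _ "\<lambda>x. f' x + g' x"] function_algebra.add) auto
next
  case (mult f g)
  then obtain f' g' where "f' \<in> polyfun (cnj ` F) n" "g' \<in> polyfun (cnj ` F) n"
    "\<forall>x\<in>carrier_vec n. f' x = cnj (f (conj_map x))" "\<forall>x\<in>carrier_vec n. g' x = cnj (g (conj_map x))"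
    by blast
  then show ?case
    by (intro bexI[of _ "\<lambda>x. f' x * g' x"] function_algebra.mult) auto
qed

lemma real_polyfun_conj_map:
  assumes "f \<in> polyfun F n" "F \<subseteq> \<real>" "x \<in> carrier_vec n"
  shows "f (conj_map x) = cnj (f x)"
  using assms(1) by induction (use assms(2,3) in \<open>auto simp: conj_map_index Reals_cnj_iff\<close>)

text \<open>The conjugates of the equations of \<open>X\<close> define the conjugate variety, and their coefficients lie in
  \<open>F\<close> again.\<close>

lemma separating_conjugate_equation:
  assumes F: "complex_subfield F" "cnj ` F = F" and X: "algebraic_set_over F n X"
    and x: "x \<in> carrier_vec n" "x \<notin> conj_map ` X"
  shows "\<exists>p\<in>polyfun F n. p x \<noteq> 0 \<and> (\<forall>z\<in>conj_map ` X. p z = 0)"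
proof -
  obtain H where H: "H \<subseteq> polyfun F n" "X = {x \<in> carrier_vec n. \<forall>h\<in>H. h x = 0}"
    using X unfolding algebraic_set_over_iff_polyfun[OF F(1)] by blast
  have "conj_map x \<notin> X" using x(2) image_eqI[of x conj_map "conj_map x" X] by auto
  then obtain h where h: "h \<in> H" "h (conj_map x) \<noteq> 0" using H(2) x(1) by auto
  obtain p where p: "p \<in> polyfun F n" "\<forall>x\<in>carrier_vec n. p x = cnj (h (conj_map x))"
    using polyfun_conjugate[of h F n] h(1) H(1) F(2) by auto
  moreover have "p x \<noteq> 0" using p(2) h(2) x(1) by simp
  moreover have "p z = 0" if "z \<in> conj_map ` X" for z
    using that p(2) h(1) H(2) by auto
  ultimately show ?thesis by blast
qed

text \<open>With \<open>b\<close> purely imaginary, \<open>F = (F \<inter> \<real>) + b (F \<inter> \<real>)\<close>, and \<open>b\<^sup>2\<close> lies in \<open>F \<inter> \<real>\<close>. The parts \<open>u\<close>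
  and \<open>v\<close> have real coefficients, though their values need not be real.\<close>

lemma polyfun_real_imaginary_parts:
  assumes F: "complex_subfield F" "cnj ` F = F" and b: "b \<in> F" "cnj b = - b" "b \<noteq> 0"
    and f: "f \<in> polyfun F n"
  shows "\<exists>u\<in>polyfun (F \<inter> \<real>) n. \<exists>v\<in>polyfun (F \<inter> \<real>) n. \<forall>x. f x = u x + b * v x"
  using f
proof induction
  case (const c)
  note closed = complex_subfield_closed[OF F(1)]
  have "cnj c \<in> F" using const F(2) by blast
  have "(c + cnj c) / 2 \<in> F \<inter> \<real>"
    using closed(8)[OF closed(3)[OF const \<open>cnj c \<in> F\<close>] closed(9)] by (simp add: Reals_cnj_iff)
  moreover have "(c - cnj c) / (2 * b) \<in> F \<inter> \<real>"
    using closed(8)[OF closed(6)[OF const \<open>cnj c \<in> F\<close>] closed(4)[OF closed(9) b(1)]] b(2,3)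
    by (simp add: Reals_cnj_iff field_simps)
  moreover have "c = (c + cnj c) / 2 + b * ((c - cnj c) / (2 * b))"
    using b(3) by (simp add: field_simps)
  ultimately show ?case
    by (intro bexI[of _ "\<lambda>_. (c + cnj c) / 2"] bexI[of _ "\<lambda>_. (c - cnj c) / (2 * b)"]
        function_algebra.const allI) auto
next
  case (gen g)
  then show ?case
    using complex_subfield_closed(1)[OF F(1)]
    by (intro bexI[of _ g] bexI[of _ "\<lambda>_. 0"] function_algebra.const function_algebra.gen) auto
next
  case (add f g)
  then obtain u v u' v' where uv: "u \<in> polyfun (F \<inter> \<real>) n" "v \<in> polyfun (F \<inter> \<real>) n"
      "\<forall>x. f x = u x + b * v x"
    and uv': "u' \<in> polyfun (F \<inter> \<real>) n" "v' \<in> polyfun (F \<inter> \<real>) n" "\<forall>x. g x = u' x + b * v' x"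
    by blast
  then show ?case
    by (intro bexI[of _ "\<lambda>x. u x + u' x"] bexI[of _ "\<lambda>x. v x + v' x"] function_algebra.add allI)
      (auto simp: algebra_simps)
next
  case (mult f g)
  then obtain u v u' v' where uv: "u \<in> polyfun (F \<inter> \<real>) n" "v \<in> polyfun (F \<inter> \<real>) n"
      "\<forall>x. f x = u x + b * v x"
    and uv': "u' \<in> polyfun (F \<inter> \<real>) n" "v' \<in> polyfun (F \<inter> \<real>) n" "\<forall>x. g x = u' x + b * v' x"
    by blast
  have "b * b \<in> F \<inter> \<real>"
    using b complex_subfield_closed(4)[OF F(1)] by (simp add: Reals_cnj_iff)
  with uv uv' show ?case
    by (intro bexI[of _ "\<lambda>x. u x * u' x + b * b * (v x * v' x)"]
        bexI[of _ "\<lambda>x. u x * v' x + v x * u' x"] function_algebra.add function_algebra.mult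
        function_algebra.const allI)
      (auto simp: algebra_simps)
qed

text \<open>An equation \<open>u + b v = 0\<close> of \<open>Z\<close> holds at \<open>x\<close> and at its conjugate. Conjugating the latter gives
  \<open>u(x) - b v(x) = 0\<close>, hence \<open>u\<close> and \<open>v\<close> vanish on \<open>Z\<close> separately and can replace the equation.\<close>

theorem descent_to_real_subfield:
  assumes F: "complex_subfield F" "cnj ` F = F" "\<not> F \<subseteq> \<real>"
    and Z: "algebraic_set_over F n Z" and conj: "conj_map ` Z \<subseteq> Z"
  shows "algebraic_set_over (F \<inter> \<real>) n Z"
proof -
  obtain H where H: "finite H" "H \<subseteq> polyfun F n" "Z = {x \<in> carrier_vec n. \<forall>h\<in>H. h x = 0}"
    using Z unfolding algebraic_set_over_iff_polyfun[OF F(1)] by blast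
  obtain q where q: "q \<in> F" "q \<notin> \<real>" using F(3) by blast
  \<comment> \<open>Twice the imaginary part of \<open>q\<close>, times \<open>\<i>\<close>: nonzero since \<open>q\<close> is not real.\<close>
  define b where "b = q - cnj q"
  have b: "b \<in> F" "cnj b = - b" "b \<noteq> 0"
    using q F(2) complex_subfield_closed(6)[OF F(1), of q "cnj q"]
    by (auto simp: b_def Reals_cnj_iff)
  define parts where "parts h uv \<longleftrightarrow> fst uv \<in> polyfun (F \<inter> \<real>) n \<and> snd uv \<in> polyfun (F \<inter> \<real>) n \<and>
      (\<forall>x. h x = fst uv x + b * snd uv x)" for h and uv :: "(complex vec \<Rightarrow> complex) \<times> (complex vec \<Rightarrow> complex)"
  have "\<exists>uv. parts h uv" if "h \<in> H" for h
    using polyfun_real_imaginary_parts[OF F(1,2) b, of h n] that H(2) unfolding parts_def by auto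
  then obtain uv where "\<forall>h\<in>H. parts h (uv h)" using bchoice[of H parts] by blast
  moreover define u v where "u h = fst (uv h)" and "v h = snd (uv h)" for h
  ultimately have uv: "\<And>h. h \<in> H \<Longrightarrow> u h \<in> polyfun (F \<inter> \<real>) n"
      "\<And>h. h \<in> H \<Longrightarrow> v h \<in> polyfun (F \<inter> \<real>) n"
      "\<And>h x. h \<in> H \<Longrightarrow> h x = u h x + b * v h x"
    unfolding parts_def by auto
  have zero: "u h x = 0 \<and> v h x = 0" if "h \<in> H" "x \<in> Z" for h x
  proof -
    have carr: "x \<in> carrier_vec n" using that H(3) by blast
    have "conj_map x \<in> Z" using that conj by blast
    then have "h (conj_map x) = 0" "h x = 0" using that H(3) by auto
    moreover have "u h (conj_map x) = cnj (u h x)" "v h (conj_map x) = cnj (v h x)"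
      using uv(1,2)[OF that(1)] carr by (auto intro!: real_polyfun_conj_map)
    ultimately have *: "u h x + b * v h x = 0" "cnj (u h x) + b * cnj (v h x) = 0"
      using uv(3)[OF that(1)] by auto
    have "u h x - b * v h x = cnj (cnj (u h x) + b * cnj (v h x))" using b(2) by simp
    with * have "u h x + b * v h x = 0" "u h x - b * v h x = 0" by simp_all
    then have "u h x = 0" "b * v h x = 0"
      using sum_diff_eqD[of "u h x" "b * v h x" 0 0] by auto
    then show ?thesis using b(3) by simp
  qed
  have "Z = {x \<in> carrier_vec n. \<forall>f\<in>u ` H \<union> v ` H. f x = 0}"
  proof (intro equalityI subsetI)
    fix x assume "x \<in> Z"
    then show "x \<in> {x \<in> carrier_vec n. \<forall>f\<in>u ` H \<union> v ` H. f x = 0}" using zero H(3) by auto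
  next
    fix x assume x: "x \<in> {x \<in> carrier_vec n. \<forall>f\<in>u ` H \<union> v ` H. f x = 0}"
    have "h x = 0" if "h \<in> H" for h
    proof -
      have "u h x = 0" "v h x = 0" using x that by auto
      then show ?thesis using uv(3)[OF that] by simp
    qed
    then show "x \<in> Z" using x H(3) by auto
  qed
  then show ?thesis
    unfolding algebraic_set_over_iff_polyfun[OF complex_subfield_Int_Reals[OF F(1)]]
    using H(1) uv(1,2) by (intro exI[of _ "u ` H \<union> v ` H"]) auto
qed


section \<open>Reconstruction of a point from its symmetric coordinates\<close>

text \<open>The inverse uses a polynomial \<open>p\<close> that is zero on the conjugate variety but not at the point
  considered. On pairs \<open>(y, T y)\<close> the symmetric polynomials \<open>p(x) + p(z)\<close> and
  \<open>x\<^sub>i p(x) + z\<^sub>i p(z)\<close> reduce to \<open>p(y)\<close> and \<open>y\<^sub>i p(y)\<close>, so their quotient recovers \<open>y\<^sub>i\<close> wherever it is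
  defined.\<close>

lemma biregular_R_map:
  assumes Q: "complex_subfield Q" "cnj ` Q = Q"
    and X: "algebraic_set_over Q n X"
    and T: "regular_map_over Q n X n (conj_map \<circ> L)"
    and L: "\<And>x. x \<in> X \<Longrightarrow> L x \<in> X"
    and disj: "X \<inter> conj_map ` X = {}"
  shows "biregular_over Q n X (symmetric_dim n) (R_map n L ` X) (R_map n L)"
proof -
  define T where "T = conj_map \<circ> L"
  have R: "R_map n L x = symmetric_coords n x (T x)" for x
    by (simp add: R_map_eq_symmetric_coords T_def)
  have X_carrier: "X \<subseteq> carrier_vec n" using X unfolding algebraic_set_over_def by blast
  have T_mem: "T x \<in> conj_map ` X" "T x \<in> carrier_vec n" if "x \<in> X" for x
    using L[OF that] X_carrier by (auto simp: T_def)
  have inj: "inj_on (R_map n L) X"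
  proof (rule inj_onI)
    fix x y assume "x \<in> X" "y \<in> X" "R_map n L x = R_map n L y"
    then have "x = y \<and> T x = T y \<or> x = T y \<and> T x = y"
      unfolding R using X_carrier T_mem by (intro symmetric_coords_eqD) auto
    then show "x = y" using T_mem(1)[OF \<open>y \<in> X\<close>] \<open>x \<in> X\<close> disj by auto
  qed
  have "regular_map_over Q n X (symmetric_dim n) (R_map n L)"
    unfolding regular_map_over_iff_polyfun[OF Q(1)]
  proof (intro ballI conjI allI impI)
    fix x k assume "x \<in> X" "k < symmetric_dim n"
    then show "\<exists>f\<in>polyfun Q n. \<exists>g\<in>polyfun Q n. g x \<noteq> 0 \<and>
        (\<forall>y\<in>X. g y \<noteq> 0 \<longrightarrow> R_map n L y $ k = f y / g y)"
      using regular_on_graph[OF Q(1) symmetric_coords_pair_polyfun[OF Q(1)] T[folded T_def]]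
      by (simp add: R)
  qed (simp add: R)
  moreover have "regular_map_over Q (symmetric_dim n) (R_map n L ` X) n (the_inv_into X (R_map n L))"
    unfolding regular_map_over_iff_polyfun[OF Q(1)]
  proof (intro ballI conjI allI impI)
    fix w assume "w \<in> R_map n L ` X"
    then obtain x where x: "x \<in> X" "w = R_map n L x" by blast
    then show "the_inv_into X (R_map n L) w \<in> carrier_vec n"
      using the_inv_into_f_f[OF inj] X_carrier by auto
    fix i assume i: "i < n"
    obtain p where p: "p \<in> polyfun Q n" "p x \<noteq> 0" "\<forall>z\<in>conj_map ` X. p z = 0"
      using separating_conjugate_equation[OF Q X, of x] X_carrier x(1) disj by blast
    have p_fst: "(\<lambda>q. p (fst q)) \<in> pair_polyfun Q n"
      by (rule function_algebra_compose[OF p(1)]) (auto intro!: function_algebra.gen)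
    have coord_p: "(\<lambda>q. fst q $ i * p (fst q)) \<in> pair_polyfun Q n"
      using i by (intro function_algebra.mult[OF function_algebra.gen p_fst]) auto
    obtain g where g: "g \<in> polyfun Q (symmetric_dim n)"
        "\<forall>x z. p x + p z = g (symmetric_coords n x z)"
      using pair_polyfun_symmetrize[OF Q(1) p_fst] unfolding fst_conv by blast
    obtain f where f: "f \<in> polyfun Q (symmetric_dim n)"
        "\<forall>x z. x $ i * p x + z $ i * p z = f (symmetric_coords n x z)"
      using pair_polyfun_symmetrize[OF Q(1) coord_p] unfolding fst_conv by blast
    have val: "g (R_map n L y) = p y" "f (R_map n L y) = y $ i * p y" if "y \<in> X" for y
      using g(2)[rule_format, of y "T y"] f(2)[rule_format, of y "T y"] p(3) T_mem(1)[OF that]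
      by (simp_all add: R)
    show "\<exists>f\<in>polyfun Q (symmetric_dim n). \<exists>g\<in>polyfun Q (symmetric_dim n). g w \<noteq> 0 \<and>
        (\<forall>y\<in>R_map n L ` X. g y \<noteq> 0 \<longrightarrow> the_inv_into X (R_map n L) y $ i = f y / g y)"
    proof (rule bexI[OF _ f(1)], rule bexI[OF _ g(1)], intro conjI ballI impI)
      show "g w \<noteq> 0" using val(1) x p(2) by simp
      fix v assume "v \<in> R_map n L ` X" "g v \<noteq> 0"
      then show "the_inv_into X (R_map n L) v $ i = f v / g v"
        using val by (auto simp: the_inv_into_f_f[OF inj])
    qed
  qed
  ultimately show ?thesis
    unfolding biregular_over_def using inj by (simp add: inj_on_imp_bij_betw)
qed

section \<open>Models over the real subfield\<close>

lemma open_dense_over_self: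
  assumes "complex_subfield F"
  shows "open_dense_over F n X X"
proof -
  have "algebraic_set_over F n {}"
    unfolding algebraic_set_over_iff_polyfun[OF assms]
    by (intro exI[of _ "{\<lambda>_. 1}"]) (auto intro: function_algebra.const complex_subfield_closed[OF assms])
  then show ?thesis unfolding open_dense_over_def by blast
qed

theorem theorem2:
  fixes Q :: "complex set" and n :: nat and X :: "complex vec set"
    and L :: "complex vec \<Rightarrow> complex vec"
  assumes "complex_subfield Q"
    and "cnj ` Q = Q"
    and "\<not> Q \<subseteq> \<real>"
    and "real_algebraic_variety n X L"
    and "real_variety_defined_over Q n X L"
    and "\<not> real_variety_defined_over (Q \<inter> \<real>) n X L"
    and "X \<inter> conj_map ` X = {}"
  shows "let N = (n^2 + 3 * n) div 2; R = R_map n L; Z = R ` X in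
    algebraic_set_over (Q \<inter> \<real>) N Z \<and>
    (birational_over Q n X N Z R \<and>
      (polynomial_map n X n (conj_map \<circ> L) \<longrightarrow> biregular_over Q n X N Z R)) \<and>
    (inj_on R X \<and> (\<forall>w\<in>Z. (R \<circ> L \<circ> the_inv_into X R) w = conj_map w))"
proof -
  let ?N = "symmetric_dim n" and ?R = "R_map n L"
  note Q = assms(1-3)
  have X: "algebraic_set_over Q n X" and T: "regular_map_over Q n X n (conj_map \<circ> L)"
    using assms(5) unfolding real_variety_defined_over_def by auto
  have L: "L x \<in> X" "L (L x) = x" if "x \<in> X" for x
    using assms(4) that unfolding real_algebraic_variety_def symmetry_def by (auto dest: bij_betwE)
  have biregular: "biregular_over Q n X ?N (?R ` X) ?R"
    by (rule biregular_R_map[OF Q(1,2) X T L(1) assms(7)])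
  then have inj: "inj_on ?R X" unfolding biregular_over_def by (auto dest: bij_betw_imp_inj_on)
  have birational: "birational_over Q n X ?N (?R ` X) ?R"
    unfolding birational_over_def using biregular open_dense_over_self[OF Q(1)] by blast
  have X_carrier: "X \<subseteq> carrier_vec n" using X unfolding algebraic_set_over_def by blast
  have conj: "?R (L x) = conj_map (?R x)" if "x \<in> X" for x
  proof -
    have carr: "x \<in> carrier_vec n" "L x \<in> carrier_vec n" using that L(1) X_carrier by auto
    have "conj_map (?R x) = symmetric_coords n (conj_map x) (L x)"
      using carr by (simp add: R_map_eq_symmetric_coords conj_map_symmetric_coords)
    also have "\<dots> = ?R (L x)"
      using L(2)[OF that] by (simp add: R_map_eq_symmetric_coords symmetric_coords_commute)
    finally show ?thesis by simp
  qed
  obtain H where H: "finite H" "H \<subseteq> pair_polyfun Q n"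
    "(\<lambda>x. (x, (conj_map \<circ> L) x)) ` X = {p \<in> carrier_vec n \<times> carrier_vec n. \<forall>h\<in>H. h p = 0}"
    using algebraic_graph[OF Q(1) X T] by blast
  have "algebraic_set_over Q ?N (?R ` X)"
    using algebraic_image_symmetric_coords[OF Q(1) H]
    by (simp add: image_image R_map_eq_symmetric_coords)
  moreover have "conj_map ` ?R ` X \<subseteq> ?R ` X"
    using conj[symmetric] L(1) by auto
  ultimately have "algebraic_set_over (Q \<inter> \<real>) ?N (?R ` X)"
    by (rule descent_to_real_subfield[OF Q])
  moreover have "(?R \<circ> L \<circ> the_inv_into X ?R) w = conj_map w" if "w \<in> ?R ` X" for w
    using that conj by (auto simp: the_inv_into_f_f[OF inj])
  ultimately show ?thesis
    unfolding Let_def using birational biregular inj by blast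
qed

end
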